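(* Let $\mathfrak A$ be an ordinary model with universe $\beta X$ (with its standard topology; powers $(\beta X)^n$ carry the product topology). Then: (i) $\mathfrak A=e(\mathfrak B)$ for some generalized model $\mathfrak B$ (in the narrow sense) iff in $\mathfrak A$ all operations are right continuous w.r.t. $X$ and all relations are right clopen w.r.t. $X$; (ii) $\mathfrak A=E(\mathfrak B)$ for some generalized model $\mathfrak B$ (in the narrow sense) iff in $\mathfrak A$ all operations are right continuous w.r.t. $X$ and all relations are regular closed.
   Context: $\beta X$ is the set of ultrafilters on $X$, $X\subseteq\beta X$ via principal ultrafilters, standard compact Hausdorff topology with base $\{\mathfrak u:A\in\mathfrak u\}$; $(\forall^{\mathfrak u}x)\varphi$ means $\{x:\varphi\}\in\mathfrak u$. An $n$-ary operation $g$ on $\beta X$ is right continuous w.r.t. $X$ if for each $i$, all $a_1,\dots,a_{i-1}\in X$ and $\mathfrak u_{i+1},\dots,\mathfrak u_n\in\beta X$, the map $\mathfrak u\mapsto g(a_1,\dots,a_{i-1},\mathfrak u,\mathfrak u_{i+1},\dots,\mathfrak u_n)$ is continuous; a relation is right clopen w.r.t. $X$ if all such sections $\{\mathfrak u:(a_1,\dots,a_{i-1},\mathfrak u,\mathfrak u_{i+1},\dots,\mathfrak u_n)\in Q\}$ are clopen; a set is regular closed if it is the closure of an open set. A generalized model in the narrow sense with universe $\beta X$ is an interpretation $\imath$ with $\imath(F)\in\beta(X^{X^n})$ for $n$-ary functional symbols and $\imath(R)\in\beta\,\mathcal P(X^n)$ for $n$-ary predicate symbols. For $f:X^n\to X$,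 $\tilde f(\mathfrak u_1,\dots,\mathfrak u_n)=\{A:(\forall^{\mathfrak u_1}x_1)\cdots(\forall^{\mathfrak u_n}x_n)f(x_1,\dots,x_n)\in A\}$; for $Q\subseteq X^n$, $\tilde Q=\{(\mathfrak u_i):(\forall^{\mathfrak u_1}x_1)\cdots(\forall^{\mathfrak u_n}x_n)(x_1,\dots,x_n)\in Q\}$. $e=E$ on $\beta(X^{X^n})$ is the unique continuous extension of $f\mapsto\tilde f$ into the space of $n$-ary operations on $\beta X$ right continuous w.r.t. $X$, topologized by pointwise convergence on $X^n$ (compact Hausdorff). $e$ on $\beta\,\mathcal P(X^n)$ is the same construction after identifying relations with characteristic functions into discrete $\{0,1\}$ (extension $Q\mapsto\tilde Q$). $E(\mathfrak r)=\{(\pi_1(\mathfrak q),\dots,\pi_n(\mathfrak q)):\mathfrak q\in e_1(\mathfrak r)\}$ where $e_1(\mathfrak r)\subseteq\beta(X^n)$ is the $e$-construction applied to $\mathfrak r$ viewed as an ultrafilter over unary relations on $X^n$, and $\pi_i(\mathfrak q)=\{A:\{x\in X^n:x_i\in A\}\in\mathfrak q\}$. For $\mathfrak B$ with interpretation $\imath$, $e(\mathfrak B)=(\beta X,e(\imath(F)),\dots,e(\imath(R)),\dots)$, $E(\mathfrak B)=(\beta X,E(\imath(F)),\dots,E(\imath(R)),\dots)$. *)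

theory Defs
  imports "HOL-Analysis.Analysis"
begin

section \<open>Ultrafilters and the space \<open>\<beta>S\<close>\<close>

definition ultrafilters :: "'a set \<Rightarrow> 'a set set set" where
  "ultrafilters S = {U. U \<subseteq> Pow S \<and> S \<in> U \<and> {} \<notin> U \<and>
     (\<forall>A\<in>U. \<forall>B\<in>U. A \<inter> B \<in> U) \<and>
     (\<forall>A\<in>U. \<forall>B. A \<subseteq> B \<and> B \<subseteq> S \<longrightarrow> B \<in> U) \<and>
     (\<forall>A. A \<subseteq> S \<longrightarrow> A \<in> U \<or> S - A \<in> U)}"

definition principal_uf :: "'a set \<Rightarrow> 'a \<Rightarrow> 'a set set" where
  "principal_uf S x = {A. A \<subseteq> S \<and> x \<in> A}"

definition beta_top :: "'a set \<Rightarrow> 'a set set topology" where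
  "beta_top S = topology_generated_by {{U \<in> ultrafilters S. A \<in> U} | A. A \<subseteq> S}"

definition uf_map :: "'a set \<Rightarrow> 'b set \<Rightarrow> ('a \<Rightarrow> 'b) \<Rightarrow> 'a set set \<Rightarrow> 'b set set" where
  "uf_map S T f U = {B. B \<subseteq> T \<and> {x \<in> S. f x \<in> B} \<in> U}"

text \<open>The unique continuous extension of \<open>f\<close>, defined on \<open>S\<close>, to \<open>\<beta>S\<close>; the extensionality
  clause only normalizes values outside \<open>\<beta>S\<close>. The description is meaningful when \<open>T\<close> is
  compact Hausdorff and \<open>f\<close> maps \<open>S\<close> into \<open>T\<close>.\<close>

definition beta_ext :: "'a set \<Rightarrow> 'b topology \<Rightarrow> ('a \<Rightarrow> 'b) \<Rightarrow> 'a set set \<Rightarrow> 'b" where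
  "beta_ext S T f = (THE g. g \<in> extensional (ultrafilters S) \<and>
     continuous_map (beta_top S) T g \<and> (\<forall>x\<in>S. g (principal_uf S x) = f x))"


section \<open>Finite powers, right continuity, right clopenness\<close>

text \<open>\<open>n\<close>-tuples are extensional functions on \<open>{..<n}\<close>, so coordinates are numbered from \<open>0\<close>.\<close>

abbreviation tuples :: "nat \<Rightarrow> 'a set \<Rightarrow> (nat \<Rightarrow> 'a) set" where
  "tuples n S \<equiv> {..<n} \<rightarrow>\<^sub>E S"

definition principal_tuple :: "nat \<Rightarrow> 'a set \<Rightarrow> (nat \<Rightarrow> 'a) \<Rightarrow> nat \<Rightarrow> 'a set set" where
  "principal_tuple n X x = (\<lambda>i\<in>{..<n}. principal_uf X (x i))"

text \<open>Below, the coordinates of \<open>v\<close> before \<open>i\<close> are in \<open>X\<close>, those after \<open>i\<close> are arbitrary in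
  \<open>\<beta>X\<close>, and coordinate \<open>i\<close> itself is overwritten.\<close>

definition right_continuous ::
  "nat \<Rightarrow> 'a set \<Rightarrow> 'b topology \<Rightarrow> ((nat \<Rightarrow> 'a set set) \<Rightarrow> 'b) \<Rightarrow> bool" where
  "right_continuous n X T g \<longleftrightarrow>
     (\<forall>i<n. \<forall>v \<in> tuples n (ultrafilters X).
        (\<forall>j<i. v j \<in> principal_uf X ` X) \<longrightarrow>
        continuous_map (beta_top X) T (\<lambda>u. g (v(i := u))))"

definition right_clopen :: "nat \<Rightarrow> 'a set \<Rightarrow> (nat \<Rightarrow> 'a set set) set \<Rightarrow> bool" where
  "right_clopen n X Q \<longleftrightarrow>
     (\<forall>i<n. \<forall>v \<in> tuples n (ultrafilters X).
        (\<forall>j<i. v j \<in> principal_uf X ` X) \<longrightarrow>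
        openin (beta_top X) {u \<in> ultrafilters X. v(i := u) \<in> Q} \<and>
        closedin (beta_top X) {u \<in> ultrafilters X. v(i := u) \<in> Q})"

definition regular_closed :: "'b topology \<Rightarrow> 'b set \<Rightarrow> bool" where
  "regular_closed T S \<longleftrightarrow> (\<exists>U. openin T U \<and> S = T closure_of U)"

definition rc_ops ::
  "nat \<Rightarrow> 'a set \<Rightarrow> 'b topology \<Rightarrow> ((nat \<Rightarrow> 'a set set) \<Rightarrow> 'b) set" where
  "rc_ops n X T =
     {g \<in> tuples n (ultrafilters X) \<rightarrow>\<^sub>E topspace T. right_continuous n X T g}"

text \<open>Pointwise convergence on \<open>X\<^sup>n\<close>: the topology induced by restricting operations to the
  tuples of principal ultrafilters.\<close>

definition rc_top ::
  "nat \<Rightarrow> 'a set \<Rightarrow> 'b topology \<Rightarrow> ((nat \<Rightarrow> 'a set set) \<Rightarrow> 'b) topology" where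
  "rc_top n X T =
     pullback_topology (rc_ops n X T)
       (\<lambda>g. \<lambda>x\<in>tuples n X. g (principal_tuple n X x))
       (product_topology (\<lambda>_. T) (tuples n X))"

text \<open>Relations are identified with their characteristic functions into discrete \<open>bool\<close>.\<close>

definition rc_rel_top :: "nat \<Rightarrow> 'a set \<Rightarrow> (nat \<Rightarrow> 'a set set) set topology" where
  "rc_rel_top n X =
     pullback_topology {Q. Q \<subseteq> tuples n (ultrafilters X) \<and> right_clopen n X Q}
       (\<lambda>Q. \<lambda>u\<in>tuples n (ultrafilters X). u \<in> Q)
       (rc_top n X (discrete_topology (UNIV :: bool set)))"


section \<open>Ultrafilter extensions of operations and relations\<close>

text \<open>\<open>uf_all X u n P\<close> is \<open>(\<forall>\<^bsup>u 0\<^esup> x\<^sub>0) \<dots> (\<forall>\<^bsup>u (n-1)\<^esup> x\<^sub>n\<^sub>-\<^sub>1) P (x\<^sub>0, \<dots>, x\<^sub>n\<^sub>-\<^sub>1)\<close>,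
  with the quantifier for \<open>u 0\<close> outermost; the recursion peels off the innermost one.\<close>

primrec uf_all ::
  "'a set \<Rightarrow> (nat \<Rightarrow> 'a set set) \<Rightarrow> nat \<Rightarrow> ((nat \<Rightarrow> 'a) \<Rightarrow> bool) \<Rightarrow> bool" where
  "uf_all X u 0 P = P (\<lambda>_. undefined)"
| "uf_all X u (Suc n) P = uf_all X u n (\<lambda>x. {y \<in> X. P (x(n := y))} \<in> u n)"

definition tilde_fun ::
  "nat \<Rightarrow> 'a set \<Rightarrow> ((nat \<Rightarrow> 'a) \<Rightarrow> 'a) \<Rightarrow> (nat \<Rightarrow> 'a set set) \<Rightarrow> 'a set set" where
  "tilde_fun n X f =
     (\<lambda>u\<in>tuples n (ultrafilters X). {A. A \<subseteq> X \<and> uf_all X u n (\<lambda>x. f x \<in> A)})"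

definition tilde_rel ::
  "nat \<Rightarrow> 'a set \<Rightarrow> (nat \<Rightarrow> 'a) set \<Rightarrow> (nat \<Rightarrow> 'a set set) set" where
  "tilde_rel n X Q = {u \<in> tuples n (ultrafilters X). uf_all X u n (\<lambda>x. x \<in> Q)}"


section \<open>The maps \<open>e\<close> and \<open>E\<close>\<close>

definition e_fun ::
  "nat \<Rightarrow> 'a set \<Rightarrow> ((nat \<Rightarrow> 'a) \<Rightarrow> 'a) set set \<Rightarrow> (nat \<Rightarrow> 'a set set) \<Rightarrow> 'a set set" where
  "e_fun n X = beta_ext (tuples n X \<rightarrow>\<^sub>E X) (rc_top n X (beta_top X)) (tilde_fun n X)"

definition e_rel ::
  "nat \<Rightarrow> 'a set \<Rightarrow> (nat \<Rightarrow> 'a) set set set \<Rightarrow> (nat \<Rightarrow> 'a set set) set" where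
  "e_rel n X = beta_ext (Pow (tuples n X)) (rc_rel_top n X) (tilde_rel n X)"

definition tuple1 :: "'b \<Rightarrow> nat \<Rightarrow> 'b" where
  "tuple1 y = (\<lambda>i\<in>{..<1}. y)"

text \<open>For an ultrafilter \<open>r\<close> over subsets of \<open>Y\<close>, transport \<open>r\<close> along the identification of
  \<open>Y\<close> with \<open>Y\<^sup>1\<close>, apply \<open>e\<close> for unary relations on \<open>Y\<close>, and identify \<open>(\<beta>Y)\<^sup>1\<close> with \<open>\<beta>Y\<close>.\<close>

definition e_unary :: "'b set \<Rightarrow> 'b set set set \<Rightarrow> 'b set set set" where
  "e_unary Y r = {q \<in> ultrafilters Y.
     tuple1 q \<in> e_rel 1 Y (uf_map (Pow Y) (Pow (tuples 1 Y)) (\<lambda>Q. tuple1 ` Q) r)}"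

definition E_rel ::
  "nat \<Rightarrow> 'a set \<Rightarrow> (nat \<Rightarrow> 'a) set set set \<Rightarrow> (nat \<Rightarrow> 'a set set) set" where
  "E_rel n X r =
     (\<lambda>q. \<lambda>i\<in>{..<n}. uf_map (tuples n X) X (\<lambda>x. x i) q) ` e_unary (tuples n X) r"


section \<open>Ordinary and generalized models\<close>

text \<open>Carrier sets of symbols are used so that a signature may lack function or predicate symbols.\<close>

record ('f, 'r) signature =
  fun_syms :: "'f set"
  rel_syms :: "'r set"
  fun_arity :: "'f \<Rightarrow> nat"
  rel_arity :: "'r \<Rightarrow> nat"

record ('f, 'r, 'u) model =
  universe :: "'u set"
  fun_int :: "'f \<Rightarrow> (nat \<Rightarrow> 'u) \<Rightarrow> 'u"
  rel_int :: "'r \<Rightarrow> (nat \<Rightarrow> 'u) set"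

text \<open>Interpretations are extensional, so that equality of records is equality of models.\<close>

definition ordinary_model :: "('f, 'r) signature \<Rightarrow> ('f, 'r, 'u) model \<Rightarrow> bool" where
  "ordinary_model \<sigma> A \<longleftrightarrow>
     universe A \<noteq> {} \<and>
     fun_int A \<in>
       (\<Pi>\<^sub>E F\<in>fun_syms \<sigma>. tuples (fun_arity \<sigma> F) (universe A) \<rightarrow>\<^sub>E universe A) \<and>
     rel_int A \<in> (\<Pi>\<^sub>E R\<in>rel_syms \<sigma>. Pow (tuples (rel_arity \<sigma> R) (universe A)))"

record ('f, 'r, 'a) gmodel =
  gfun_int :: "'f \<Rightarrow> ((nat \<Rightarrow> 'a) \<Rightarrow> 'a) set set"
  grel_int :: "'r \<Rightarrow> (nat \<Rightarrow> 'a) set set set"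

definition narrow_gmodel ::
  "('f, 'r) signature \<Rightarrow> 'a set \<Rightarrow> ('f, 'r, 'a) gmodel \<Rightarrow> bool" where
  "narrow_gmodel \<sigma> X B \<longleftrightarrow>
     gfun_int B \<in> (\<Pi>\<^sub>E F\<in>fun_syms \<sigma>. ultrafilters (tuples (fun_arity \<sigma> F) X \<rightarrow>\<^sub>E X)) \<and>
     grel_int B \<in> (\<Pi>\<^sub>E R\<in>rel_syms \<sigma>. ultrafilters (Pow (tuples (rel_arity \<sigma> R) X)))"

definition e_model ::
  "('f, 'r) signature \<Rightarrow> 'a set \<Rightarrow> ('f, 'r, 'a) gmodel \<Rightarrow> ('f, 'r, 'a set set) model" where
  "e_model \<sigma> X B =
     \<lparr>universe = ultrafilters X,
      fun_int = (\<lambda>F\<in>fun_syms \<sigma>. e_fun (fun_arity \<sigma> F) X (gfun_int B F)),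
      rel_int = (\<lambda>R\<in>rel_syms \<sigma>. e_rel (rel_arity \<sigma> R) X (grel_int B R))\<rparr>"

text \<open>On operations \<open>E\<close> coincides with \<open>e\<close> by definition.\<close>

definition E_model ::
  "('f, 'r) signature \<Rightarrow> 'a set \<Rightarrow> ('f, 'r, 'a) gmodel \<Rightarrow> ('f, 'r, 'a set set) model" where
  "E_model \<sigma> X B =
     \<lparr>universe = ultrafilters X,
      fun_int = (\<lambda>F\<in>fun_syms \<sigma>. e_fun (fun_arity \<sigma> F) X (gfun_int B F)),
      rel_int = (\<lambda>R\<in>rel_syms \<sigma>. E_rel (rel_arity \<sigma> R) X (grel_int B R))\<rparr>"

end

theory Submission
  imports Defs
begin

text \<open>
  A right continuous operation or right clopen relation is determined by its values on \<open>X\<^sup>n\<close>, and any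
  \<open>h : X\<^sup>n \<rightarrow> \<beta>X\<close> extends to a right continuous operation by iterated ultrafilter quantifiers.
  Hence \<open>e\<close> sends an ultrafilter over functions to the extension of its coordinates, and it is onto
  because \<open>\<beta>(X\<^sup>I) \<rightarrow> (\<beta>X)\<^sup>I\<close> is onto for every \<open>I\<close>, in particular \<open>I = X\<^sup>n\<close>; for relations \<open>e\<close>
  factors through the limit set in \<open>X\<^sup>n\<close>, so principal ultrafilters already give all values.
  By the same map with \<open>I = n\<close>, \<open>E\<close> sends an ultrafilter over relations to the closure of its limit
  set in \<open>(\<beta>X)\<^sup>n\<close>. As \<open>X\<^sup>n\<close> is open, discrete and dense there, such closures are exactly the
  regular closed sets.
\<close>

section \<open>Ultrafilters on a set\<close>

text \<open>The last two hypotheses say that membership in \<open>U\<close> respects complements and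
  intersections. Images of ultrafilters and iterated quantifiers inherit these equivalences
  directly; upward closure comes from \<open>A \<inter> B = A\<close> for
  \<open>A \<subseteq> B\<close>.\<close>

lemma ultrafiltersI:
  assumes "U \<subseteq> Pow S" "S \<in> U"
    and "\<And>A. A \<subseteq> S \<Longrightarrow> S - A \<in> U \<longleftrightarrow> A \<notin> U"
    and "\<And>A B. A \<subseteq> S \<Longrightarrow> B \<subseteq> S \<Longrightarrow> A \<inter> B \<in> U \<longleftrightarrow> A \<in> U \<and> B \<in> U"
  shows "U \<in> ultrafilters S"
proof -
  have "{} \<notin> U"
    using assms(2) assms(3)[of "{}"] by simp
  moreover have "B \<in> U" if "A \<in> U" "A \<subseteq> B" "B \<subseteq> S" for A B
    using assms(4)[of A B] that by (simp add: Int_absorb2)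
  moreover have "A \<inter> B \<in> U" if "A \<in> U" "B \<in> U" for A B
    using assms(1) assms(4)[of A B] that by auto
  ultimately show ?thesis
    using assms(1-3) by (simp add: ultrafilters_def)
qed

lemma ultrafilter_subset: "U \<in> ultrafilters S \<Longrightarrow> A \<in> U \<Longrightarrow> A \<subseteq> S"
  by (auto simp: ultrafilters_def)

lemma ultrafilter_carrier: "U \<in> ultrafilters S \<Longrightarrow> S \<in> U"
  by (simp add: ultrafilters_def)

lemma ultrafilter_empty: "U \<in> ultrafilters S \<Longrightarrow> {} \<notin> U"
  by (simp add: ultrafilters_def)

lemma ultrafilter_mono: "U \<in> ultrafilters S \<Longrightarrow> A \<in> U \<Longrightarrow> A \<subseteq> B \<Longrightarrow> B \<subseteq> S \<Longrightarrow> B \<in> U"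
  unfolding ultrafilters_def by blast

lemma ultrafilter_Int: "U \<in> ultrafilters S \<Longrightarrow> A \<in> U \<Longrightarrow> B \<in> U \<Longrightarrow> A \<inter> B \<in> U"
  unfolding ultrafilters_def by blast

lemma ultrafilter_Int_iff:
  assumes "U \<in> ultrafilters S" "A \<subseteq> S" "B \<subseteq> S"
  shows "A \<inter> B \<in> U \<longleftrightarrow> A \<in> U \<and> B \<in> U"
  using ultrafilter_Int[OF assms(1)] ultrafilter_mono[OF assms(1)] assms(2,3)
  by (meson inf_le1 inf_le2)

lemma ultrafilter_Diff_iff:
  assumes "U \<in> ultrafilters S" "A \<subseteq> S"
  shows "S - A \<in> U \<longleftrightarrow> A \<notin> U"
proof
  show "A \<notin> U" if "S - A \<in> U"
    using ultrafilter_Int[OF assms(1) that, of A] ultrafilter_empty[OF assms(1)]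
    by (auto simp: Int_commute)
  show "S - A \<in> U" if "A \<notin> U"
    using assms that unfolding ultrafilters_def by blast
qed

lemma ultrafilter_Collect_conj:
  assumes "U \<in> ultrafilters S"
  shows "{x \<in> S. P x \<and> Q x} \<in> U \<longleftrightarrow> {x \<in> S. P x} \<in> U \<and> {x \<in> S. Q x} \<in> U"
proof -
  have "{x \<in> S. P x \<and> Q x} = {x \<in> S. P x} \<inter> {x \<in> S. Q x}"
    by blast
  then show ?thesis
    using ultrafilter_Int_iff[OF assms, of "{x \<in> S. P x}" "{x \<in> S. Q x}"] by simp
qed

lemma ultrafilter_Collect_not:
  assumes "U \<in> ultrafilters S"
  shows "{x \<in> S. \<not> P x} \<in> U \<longleftrightarrow> {x \<in> S. P x} \<notin> U"
proof -
  have "{x \<in> S. \<not> P x} = S - {x \<in> S. P x}"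
    by blast
  then show ?thesis
    using ultrafilter_Diff_iff[OF assms, of "{x \<in> S. P x}"] by simp
qed

text \<open>Maximality: if \<open>A\<close> lies in \<open>V\<close>, then \<open>S - A\<close> is
  not in \<open>V\<close>, hence not in \<open>U\<close>, and so \<open>A\<close> lies in
  \<open>U\<close>. Later equalities of ultrafilters are reduced to one inclusion this way.\<close>

lemma ultrafilter_subset_eq:
  assumes "U \<in> ultrafilters S" "V \<in> ultrafilters S" "U \<subseteq> V"
  shows "U = V"
proof
  show "V \<subseteq> U"
  proof
    fix A assume A: "A \<in> V"
    then have "S - A \<notin> V" "A \<subseteq> S"
      using assms(2) ultrafilter_Diff_iff ultrafilter_subset by blast+
    then show "A \<in> U"
      using assms(1,3) ultrafilter_Diff_iff by blast
  qed
qed (fact assms(3))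

lemma principal_ultrafilter: "x \<in> S \<Longrightarrow> principal_uf S x \<in> ultrafilters S"
  by (rule ultrafiltersI) (auto simp: principal_uf_def)

lemma uf_map_iff: "B \<in> uf_map S T f U \<longleftrightarrow> B \<subseteq> T \<and> {x \<in> S. f x \<in> B} \<in> U"
  by (simp add: uf_map_def)

lemma uf_map_ultrafilter:
  assumes "U \<in> ultrafilters S" "f \<in> S \<rightarrow> T"
  shows "uf_map S T f U \<in> ultrafilters T"
proof (rule ultrafiltersI)
  have "{x \<in> S. f x \<in> T} = S"
    using assms(2) by auto
  then show "T \<in> uf_map S T f U"
    using ultrafilter_carrier[OF assms(1)] by (simp add: uf_map_def)
next
  fix A assume A: "A \<subseteq> T"
  have "{x \<in> S. f x \<in> T - A} = {x \<in> S. \<not> f x \<in> A}"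
    using assms(2) by auto
  then show "T - A \<in> uf_map S T f U \<longleftrightarrow> A \<notin> uf_map S T f U"
    using A by (simp add: uf_map_def ultrafilter_Collect_not[OF assms(1)])
qed (auto simp: uf_map_def ultrafilter_Collect_conj[OF assms(1)])

lemma uf_map_principal:
  "x \<in> S \<Longrightarrow> uf_map S T f (principal_uf S x) = principal_uf T (f x)"
  by (auto simp: uf_map_def principal_uf_def)

text \<open>Zorn's lemma is applied to downward directed families without the empty set instead of
  filters; a maximal such family turns out to be upward closed and an ultrafilter.\<close>

lemma ultrafilter_extending_base:
  assumes "\<B> \<noteq> {}" and sub: "\<B> \<subseteq> Pow S" and ne: "{} \<notin> \<B>"
    and dir: "\<And>A B. A \<in> \<B> \<Longrightarrow> B \<in> \<B> \<Longrightarrow> \<exists>C\<in>\<B>. C \<subseteq> A \<inter> B"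
  obtains U where "U \<in> ultrafilters S" "\<B> \<subseteq> U"
proof -
  define \<F> where "\<F> = {F. \<B> \<subseteq> F \<and> F \<subseteq> Pow S \<and> {} \<notin> F \<and> (\<forall>A\<in>F. \<forall>B\<in>F. \<exists>C\<in>F. C \<subseteq> A \<inter> B)}"
  have "\<exists>M\<in>\<F>. \<forall>F\<in>\<F>. M \<subseteq> F \<longrightarrow> F = M"
  proof (rule subset_Zorn_nonempty)
    have "\<B> \<in> \<F>"
      using sub ne dir by (simp add: \<F>_def)
    then show "\<F> \<noteq> {}"
      by blast
  next
    fix \<C> assume \<C>: "\<C> \<noteq> {}" "subset.chain \<F> \<C>"
    have "\<exists>C\<in>\<Union>\<C>. C \<subseteq> A \<inter> B" if AB: "A \<in> \<Union>\<C>" "B \<in> \<Union>\<C>" for A B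
    proof -
      obtain F G where "F \<in> \<C>" "A \<in> F" "G \<in> \<C>" "B \<in> G"
        using AB by blast
      then obtain H where "H \<in> \<C>" "A \<in> H" "B \<in> H"
        using \<C>(2) unfolding subset_chain_def by blast
      moreover from this have "H \<in> \<F>"
        using \<C>(2) by (auto simp: subset_chain_def)
      ultimately show ?thesis
        unfolding \<F>_def mem_Collect_eq by (meson UnionI)
    qed
    moreover have "\<B> \<subseteq> F \<and> F \<subseteq> Pow S \<and> {} \<notin> F" if "F \<in> \<C>" for F
    proof -
      have "F \<in> \<F>"
        using \<C>(2) that by (auto simp: subset_chain_def)
      then show ?thesis
        by (simp add: \<F>_def)
    qed
    then have "\<B> \<subseteq> \<Union>\<C>" "\<Union>\<C> \<subseteq> Pow S" "{} \<notin> \<Union>\<C>"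
      using \<C>(1) by blast+
    ultimately show "\<Union>\<C> \<in> \<F>"
      unfolding \<F>_def by (intro CollectI conjI ballI) simp_all
  qed
  then obtain M where "M \<in> \<F>" and max: "\<And>F. F \<in> \<F> \<Longrightarrow> M \<subseteq> F \<Longrightarrow> F = M"
    by blast
  then have M: "\<B> \<subseteq> M" "M \<subseteq> Pow S" "{} \<notin> M"
      "\<And>A B. A \<in> M \<Longrightarrow> B \<in> M \<Longrightarrow> \<exists>C\<in>M. C \<subseteq> A \<inter> B"
    by (simp_all add: \<F>_def)
  \<comment> \<open>The sets that include some \<open>A \<inter> B\<close> with \<open>B\<close> in
    \<open>M\<close> form a directed family containing \<open>M\<close>, proper because
    \<open>A\<close> meets every member of \<open>M\<close>. By maximality it equals
    \<open>M\<close>, so \<open>A\<close> is in \<open>M\<close>.\<close>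
  have meets: "A \<in> M" if A: "A \<subseteq> S" and meet: "\<And>B. B \<in> M \<Longrightarrow> A \<inter> B \<noteq> {}" for A
  proof -
    define F where "F = {C. C \<subseteq> S \<and> (\<exists>B\<in>M. A \<inter> B \<subseteq> C)}"
    have "M \<subseteq> F"
      using M(2) unfolding F_def by blast
    moreover have "\<exists>C\<in>F. C \<subseteq> C1 \<inter> C2" if C: "C1 \<in> F" "C2 \<in> F" for C1 C2
    proof -
      obtain B1 B2 where B: "B1 \<in> M" "A \<inter> B1 \<subseteq> C1" "B2 \<in> M" "A \<inter> B2 \<subseteq> C2"
        using C unfolding F_def by blast
      then obtain B where "B \<in> M" "B \<subseteq> B1 \<inter> B2"
        using M(4)[OF B(1,3)] by blast
      then have "A \<inter> B \<in> F" "A \<inter> B \<subseteq> C1 \<inter> C2"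
        using A B unfolding F_def by blast+
      then show ?thesis by blast
    qed
    moreover have "{} \<notin> F"
      using meet unfolding F_def by blast
    moreover have "F \<subseteq> Pow S"
      unfolding F_def by blast
    ultimately have "F \<in> \<F>"
      using M(1) by (simp add: \<F>_def)
    then have "F = M"
      using max \<open>M \<subseteq> F\<close> by blast
    moreover have "A \<in> F"
      using A M(1) assms(1) unfolding F_def by blast
    ultimately show ?thesis by simp
  qed
  have up: "B \<in> M" if "A \<in> M" "A \<subseteq> B" "B \<subseteq> S" for A B
  proof (rule meets)
    fix C assume "C \<in> M"
    then obtain D where "D \<in> M" "D \<subseteq> A \<inter> C"
      using M(4)[OF \<open>A \<in> M\<close> \<open>C \<in> M\<close>] by blast
    moreover from this have "D \<noteq> {}"
      using M(3) by metis
    ultimately show "B \<inter> C \<noteq> {}"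
      using that(2) by blast
  qed (fact that(3))
  have "M \<in> ultrafilters S"
  proof -
    have "A \<inter> B \<in> M" if AB: "A \<in> M" "B \<in> M" for A B
    proof -
      obtain C where "C \<in> M" "C \<subseteq> A \<inter> B"
        using M(4)[OF AB] by blast
      then show ?thesis
        using up[of C "A \<inter> B"] M(2) AB(1) by blast
    qed
    moreover have "S \<in> M"
    proof -
      obtain B where "B \<in> M"
        using assms(1) M(1) by blast
      then show ?thesis
        using up[of B S] M(2) by blast
    qed
    moreover have "A \<in> M \<or> S - A \<in> M" if A: "A \<subseteq> S" for A
    proof (cases "A \<in> M")
      case False
      then have "\<exists>B\<in>M. A \<inter> B = {}"
        using meets[OF A] by metis
      then obtain B where "B \<in> M" "A \<inter> B = {}"
        by blast
      moreover from this have "B \<subseteq> S - A"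
        using M(2) by auto
      ultimately show ?thesis
        using up[of B "S - A"] by simp
    qed simp
    ultimately show ?thesis
      using M(2,3) up by (simp add: ultrafilters_def)
  qed
  then show ?thesis
    using that M(1) by blast
qed

section \<open>The topology of \<open>\<beta>S\<close>\<close>

definition ufs_containing :: "'a set \<Rightarrow> 'a set \<Rightarrow> 'a set set set" where
  "ufs_containing S A = {U \<in> ultrafilters S. A \<in> U}"

lemma topspace_beta_top [simp]: "topspace (beta_top S) = ultrafilters S"
  unfolding beta_top_def topology_generated_by_topspace
  using ultrafilter_carrier by blast

lemma openin_ufs_containing: "A \<subseteq> S \<Longrightarrow> openin (beta_top S) (ufs_containing S A)"
  unfolding beta_top_def ufs_containing_def by (rule topology_generated_by_Basis) blast

lemma closedin_ufs_containing:
  assumes "A \<subseteq> S"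
  shows "closedin (beta_top S) (ufs_containing S A)"
proof -
  have "ultrafilters S - ufs_containing S A = ufs_containing S (S - A)"
    using assms by (auto simp: ufs_containing_def ultrafilter_Diff_iff)
  then show ?thesis
    unfolding closedin_def
    using openin_ufs_containing[of "S - A" S] by (auto simp: ufs_containing_def)
qed

text \<open>The generating sets are closed under binary intersections, since an ultrafilter contains
  \<open>A \<inter> B\<close> iff it contains both sets; so they form a base and not only a
  subbase.\<close>

lemma openin_beta_top_base:
  assumes "openin (beta_top S) W" "U \<in> W"
  obtains A where "A \<in> U" "ufs_containing S A \<subseteq> W"
proof -
  have "U \<in> ultrafilters S"
    using openin_subset[OF assms(1)] assms(2) by auto
  have "\<exists>A\<in>U. ufs_containing S A \<subseteq> W"
    if "generate_topology_on {{U \<in> ultrafilters S. A \<in> U} | A. A \<subseteq> S} W"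
    using that assms(2)
  proof (induction W rule: generate_topology_on.induct)
    case (Int V W)
    then obtain A B where AB: "A \<in> U" "ufs_containing S A \<subseteq> V" "B \<in> U" "ufs_containing S B \<subseteq> W"
      by blast
    have "A \<inter> B \<in> V' \<longleftrightarrow> A \<in> V' \<and> B \<in> V'" if "V' \<in> ultrafilters S" for V'
      using that AB ultrafilter_Int_iff ultrafilter_subset[OF \<open>U \<in> ultrafilters S\<close>] by metis
    then have "ufs_containing S (A \<inter> B) \<subseteq> V \<inter> W" "A \<inter> B \<in> U"
      using AB \<open>U \<in> ultrafilters S\<close> unfolding ufs_containing_def by blast+
    then show ?case by blast
  next
    case (UN K)
    then show ?case by blast
  next
    case (Basis s)
    then show ?case
      unfolding ufs_containing_def by blast
  qed simp
  then show ?thesis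
    using that assms(1) unfolding beta_top_def openin_topology_generated_by_iff by blast
qed

lemma continuous_map_into_beta_top:
  assumes "\<And>x. x \<in> topspace T \<Longrightarrow> f x \<in> ultrafilters S"
    and "\<And>A. A \<subseteq> S \<Longrightarrow> openin T {x \<in> topspace T. A \<in> f x}"
  shows "continuous_map T (beta_top S) f"
  unfolding beta_top_def
proof (rule continuous_on_generated_topo)
  fix W assume "W \<in> {{U \<in> ultrafilters S. A \<in> U} | A. A \<subseteq> S}"
  then obtain A where "A \<subseteq> S" "W = {U \<in> ultrafilters S. A \<in> U}"
    by blast
  moreover from this have "f -` W \<inter> topspace T = {x \<in> topspace T. A \<in> f x}"
    using assms(1) by auto
  ultimately show "openin T (f -` W \<inter> topspace T)"
    using assms(2) by simp
next
  show "f ` topspace T \<subseteq> \<Union>{{U \<in> ultrafilters S. A \<in> U} | A. A \<subseteq> S}"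
    using assms(1) ultrafilter_carrier by blast
qed

lemma Hausdorff_beta_top: "Hausdorff_space (beta_top S)"
  unfolding Hausdorff_space_def
proof (intro allI impI, elim conjE)
  fix U V assume UV: "U \<in> topspace (beta_top S)" "V \<in> topspace (beta_top S)" "U \<noteq> V"
  then obtain A where A: "A \<in> U" "A \<notin> V"
    using ultrafilter_subset_eq[of U S V] by auto
  then have "A \<subseteq> S"
    using UV(1) ultrafilter_subset by auto
  have "U \<in> ufs_containing S A" "V \<in> ufs_containing S (S - A)"
    using UV A \<open>A \<subseteq> S\<close> by (auto simp: ufs_containing_def ultrafilter_Diff_iff)
  moreover have "disjnt (ufs_containing S A) (ufs_containing S (S - A))"
    using \<open>A \<subseteq> S\<close> by (auto simp: ufs_containing_def ultrafilter_Diff_iff disjnt_iff)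
  ultimately show "\<exists>W W'. openin (beta_top S) W \<and> openin (beta_top S) W' \<and>
      U \<in> W \<and> V \<in> W' \<and> disjnt W W'"
    using openin_ufs_containing[OF \<open>A \<subseteq> S\<close>] openin_ufs_containing[of "S - A" S] by blast
qed

text \<open>A basic neighbourhood of \<open>U\<close> given by \<open>A \<in> U\<close> meets the
  principal ultrafilters of \<open>P\<close>: the set \<open>P \<inter> A\<close> is in
  \<open>U\<close>, hence nonempty, and any of its points gives one. The other inclusion holds
  because the right side is closed.\<close>

lemma closure_of_principal_ufs:
  assumes "P \<subseteq> S"
  shows "beta_top S closure_of (principal_uf S ` P) = ufs_containing S P"
proof
  have "principal_uf S ` P \<subseteq> ufs_containing S P"
    using assms principal_ultrafilter[of _ S] by (auto simp: ufs_containing_def principal_uf_def subset_iff)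
  then show "beta_top S closure_of (principal_uf S ` P) \<subseteq> ufs_containing S P"
    using closedin_ufs_containing[OF assms] closure_of_minimal by blast
  show "ufs_containing S P \<subseteq> beta_top S closure_of (principal_uf S ` P)"
  proof
    fix U assume "U \<in> ufs_containing S P"
    then have U: "U \<in> ultrafilters S" "P \<in> U"
      by (auto simp: ufs_containing_def)
    have "\<exists>y\<in>principal_uf S ` P. y \<in> W" if W: "U \<in> W" "openin (beta_top S) W" for W
    proof -
      obtain A where A: "A \<in> U" "ufs_containing S A \<subseteq> W"
        using openin_beta_top_base W by blast
      then have "P \<inter> A \<in> U"
        using U ultrafilter_Int by blast
      then obtain x where "x \<in> P" "x \<in> A"
        using ultrafilter_empty[OF U(1)] by (metis disjoint_iff)
      then have "principal_uf S x \<in> ufs_containing S A"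
        using assms principal_ultrafilter[of x S] ultrafilter_subset[OF U(1) A(1)]
        by (auto simp: ufs_containing_def principal_uf_def)
      then show ?thesis
        using A \<open>x \<in> P\<close> by blast
    qed
    then show "U \<in> beta_top S closure_of (principal_uf S ` P)"
      using U(1) unfolding in_closure_of by simp
  qed
qed

lemma principal_ufs_dense: "beta_top S closure_of (principal_uf S ` S) = ultrafilters S"
  using closure_of_principal_ufs[of S S] ultrafilter_carrier by (auto simp: ufs_containing_def)

text \<open>An ultrafilter with \<open>{x}\<close> as a member includes, hence equals, the principal
  one; so the basic set of \<open>{x}\<close> is a single point.\<close>

lemma openin_principal_uf:
  assumes "x \<in> S"
  shows "openin (beta_top S) {principal_uf S x}"
proof -
  have "U = principal_uf S x" if U: "U \<in> ultrafilters S" "{x} \<in> U" for U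
  proof -
    have "principal_uf S x \<subseteq> U"
      using U ultrafilter_mono[OF U] by (auto simp: principal_uf_def)
    then show ?thesis
      using ultrafilter_subset_eq principal_ultrafilter[OF assms] U(1) by blast
  qed
  then have "ufs_containing S {x} \<subseteq> {principal_uf S x}"
    unfolding ufs_containing_def by blast
  moreover have "principal_uf S x \<in> ufs_containing S {x}"
    using assms principal_ultrafilter[OF assms] by (simp add: ufs_containing_def principal_uf_def)
  ultimately have "ufs_containing S {x} = {principal_uf S x}"
    by blast
  then show ?thesis
    using openin_ufs_containing[of "{x}" S] assms by simp
qed

text \<open>Continuous maps into a Hausdorff space that agree on the dense set of principal
  ultrafilters coincide, so any continuous formula \<open>g\<close> with the right values computes
  the description. Values of \<open>g\<close> outside \<beta>S are arbitrary, hence the restriction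
  in the proof.\<close>

lemma beta_ext_eq:
  assumes "Hausdorff_space T" "continuous_map (beta_top S) T g"
    and "\<And>x. x \<in> S \<Longrightarrow> g (principal_uf S x) = f x" and "U \<in> ultrafilters S"
  shows "beta_ext S T f U = g U"
proof -
  have "beta_ext S T f = restrict g (ultrafilters S)"
    unfolding beta_ext_def
  proof (rule the_equality)
    show "restrict g (ultrafilters S) \<in> extensional (ultrafilters S) \<and>
        continuous_map (beta_top S) T (restrict g (ultrafilters S)) \<and>
        (\<forall>x\<in>S. restrict g (ultrafilters S) (principal_uf S x) = f x)"
      using assms(3) continuous_map_eq[OF assms(2), of "restrict g (ultrafilters S)"]
      by (simp add: principal_ultrafilter)
  next
    fix k assume k: "k \<in> extensional (ultrafilters S) \<and>
        continuous_map (beta_top S) T k \<and> (\<forall>x\<in>S. k (principal_uf S x) = f x)"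
    have "k U = g U" if "U \<in> ultrafilters S" for U
    proof (rule forall_in_closure_of_eq[where f = k and g = g])
      show "U \<in> beta_top S closure_of (principal_uf S ` S)"
        using that principal_ufs_dense by blast
      show "continuous_map (beta_top S) T k"
        using k by blast
      show "k V = g V" if "V \<in> principal_uf S ` S" for V
        using that k assms(3) by (metis imageE)
    qed (fact assms(1,2))+
    then show "k = restrict g (ultrafilters S)"
      using k by (auto simp: extensional_def)
  qed
  then show ?thesis
    using assms(4) by simp
qed

section \<open>Image maps and coordinates of ultrafilters on powers\<close>

lemma continuous_map_uf_map:
  assumes "f \<in> S \<rightarrow> T"
  shows "continuous_map (beta_top S) (beta_top T) (uf_map S T f)"
proof (rule continuous_map_into_beta_top)
  fix B assume "B \<subseteq> T"
  then have "{U \<in> topspace (beta_top S). B \<in> uf_map S T f U} = ufs_containing S {x \<in> S. f x \<in> B}"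
    by (auto simp: ufs_containing_def uf_map_def)
  then show "openin (beta_top S) {U \<in> topspace (beta_top S). B \<in> uf_map S T f U}"
    using openin_ufs_containing[of "{x \<in> S. f x \<in> B}" S] by simp
qed (use assms uf_map_ultrafilter in auto)

text \<open>The index set may be infinite: \<open>I = tuples n X\<close> gives the values, at the
  points of X^n, of an ultrafilter over operations, and \<open>I = {..<n}\<close> gives the tuple of
  projections used in \<open>E_rel\<close>.\<close>

definition uf_coords :: "'i set \<Rightarrow> 'a set \<Rightarrow> ('i \<Rightarrow> 'a) set set \<Rightarrow> 'i \<Rightarrow> 'a set set" where
  "uf_coords I X q = (\<lambda>i\<in>I. uf_map (I \<rightarrow>\<^sub>E X) X (\<lambda>x. x i) q)"

lemma continuous_map_uf_coord:
  assumes "i \<in> I"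
  shows "continuous_map (beta_top (I \<rightarrow>\<^sub>E X)) (beta_top X) (\<lambda>q. uf_coords I X q i)"
  unfolding uf_coords_def restrict_apply'[OF assms]
  by (rule continuous_map_uf_map) (rule Pi_I, erule PiE_mem, rule assms)

lemma continuous_map_uf_coords:
  "continuous_map (beta_top (I \<rightarrow>\<^sub>E X)) (product_topology (\<lambda>_. beta_top X) I) (uf_coords I X)"
  unfolding continuous_map_componentwise
  by (intro conjI ballI continuous_map_uf_coord) (simp_all add: uf_coords_def image_subset_iff)

text \<open>The inclusion from right to left is compactness: the sets of tuples in \<open>P\<close> with finitely many
  coordinates prescribed by \<open>u\<close> form a filter base.\<close>

lemma projections_image_eq_closure:
  fixes I :: "'i set" and X :: "'a set"
  assumes P: "P \<subseteq> I \<rightarrow>\<^sub>E X"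
  shows "uf_coords I X ` ufs_containing (I \<rightarrow>\<^sub>E X) P =
    product_topology (\<lambda>_. beta_top X) I closure_of ((\<lambda>x. \<lambda>i\<in>I. principal_uf X (x i)) ` P)"
    (is "_ = ?T closure_of (?D ` P)")
proof
  \<comment> \<open>This inclusion is continuity of \<open>uf_coords\<close>: the basic clopen set
    of \<open>P\<close> is the closure of the principal ultrafilters of \<open>P\<close>.\<close>
  have "uf_coords I X ` (beta_top (I \<rightarrow>\<^sub>E X) closure_of (principal_uf (I \<rightarrow>\<^sub>E X) ` P)) \<subseteq>
      ?T closure_of (uf_coords I X ` principal_uf (I \<rightarrow>\<^sub>E X) ` P)"
    using continuous_map_uf_coords by (rule continuous_map_image_closure_subset)
  moreover have "uf_coords I X ` principal_uf (I \<rightarrow>\<^sub>E X) ` P = ?D ` P"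
    unfolding image_image
  proof (rule image_cong)
    fix x assume "x \<in> P"
    then have "x \<in> I \<rightarrow>\<^sub>E X"
      using P by blast
    then show "uf_coords I X (principal_uf (I \<rightarrow>\<^sub>E X) x) = ?D x"
      by (simp only: uf_coords_def uf_map_principal)
  qed simp
  ultimately show "uf_coords I X ` ufs_containing (I \<rightarrow>\<^sub>E X) P \<subseteq> ?T closure_of (?D ` P)"
    using closure_of_principal_ufs[OF P] by simp
next
  show "?T closure_of (?D ` P) \<subseteq> uf_coords I X ` ufs_containing (I \<rightarrow>\<^sub>E X) P"
  proof
    fix u assume u: "u \<in> ?T closure_of (?D ` P)"
    then have uI: "u \<in> I \<rightarrow>\<^sub>E ultrafilters X"
      by (auto simp: in_closure_of)
    define box where "box D A = {x \<in> P. \<forall>i\<in>D. x i \<in> A i}" for D and A :: "'i \<Rightarrow> 'a set"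
    define \<B> where "\<B> = {box D A | D A. finite D \<and> D \<subseteq> I \<and> (\<forall>i\<in>D. A i \<in> u i)}"
    have "box D A \<noteq> {}" if D: "finite D" "D \<subseteq> I" "\<forall>i\<in>D. A i \<in> u i" for D A
    proof -
      \<comment> \<open>An open box around \<open>u\<close>, restricted only in the finitely many
        coordinates in \<open>D\<close>. It meets the image of \<open>P\<close> because
        \<open>u\<close> is in the closure.\<close>
      define W where "W = (\<Pi>\<^sub>E i\<in>I. if i \<in> D then ufs_containing X (A i) else ultrafilters X)"
      have "openin ?T W"
        unfolding W_def openin_PiE_gen
      proof (intro disjI2 conjI ballI)
        show "finite {i \<in> I. (if i \<in> D then ufs_containing X (A i) else ultrafilters X) \<noteq>
            topspace (beta_top X)}"
          using D(1) by (rule rev_finite_subset) auto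
      next
        fix i assume "i \<in> I"
        then have "i \<in> D \<Longrightarrow> A i \<subseteq> X"
          using uI D ultrafilter_subset[of "u i" X "A i"] by blast
        then show "openin (beta_top X) (if i \<in> D then ufs_containing X (A i) else ultrafilters X)"
          using openin_ufs_containing[of _ X] openin_topspace[of "beta_top X"] by auto
      qed
      moreover have "u \<in> W"
        using uI D unfolding W_def ufs_containing_def by (auto simp: PiE_iff)
      ultimately obtain x where x: "x \<in> P" "?D x \<in> W"
        using u unfolding in_closure_of by blast
      have "x i \<in> A i" if "i \<in> D" for i
      proof -
        have "?D x i \<in> ufs_containing X (A i)"
          using PiE_mem[OF x(2)[unfolded W_def], of i] that D(2) by auto
        then show ?thesis
          using that D(2) by (auto simp: ufs_containing_def principal_uf_def)
      qed
      then show ?thesis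
        using x(1) unfolding box_def by blast
    qed
    then have ne: "{} \<notin> \<B>"
      unfolding \<B>_def by force
    have dir: "\<exists>C\<in>\<B>. C \<subseteq> B1 \<inter> B2" if B12: "B1 \<in> \<B>" "B2 \<in> \<B>" for B1 B2
    proof -
      obtain D1 A1 D2 A2 where B: "B1 = box D1 A1" "finite D1" "D1 \<subseteq> I" "\<forall>i\<in>D1. A1 i \<in> u i"
          "B2 = box D2 A2" "finite D2" "D2 \<subseteq> I" "\<forall>i\<in>D2. A2 i \<in> u i"
        using B12 unfolding \<B>_def by blast
      \<comment> \<open>Where only one of the two boxes constrains coordinate \<open>i\<close>, the
        default \<open>X\<close> stands in for the other; it belongs to \<open>u i\<close>, so the
        intersection does too.\<close>
      define A where "A i = (if i \<in> D1 then A1 i else X) \<inter> (if i \<in> D2 then A2 i else X)" for i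
      have "A i \<in> u i" if "i \<in> D1 \<union> D2" for i
      proof -
        have "u i \<in> ultrafilters X"
          using uI B that by blast
        then have "X \<in> u i"
          by (rule ultrafilter_carrier)
        then show ?thesis
          unfolding A_def using B by (intro ultrafilter_Int[OF \<open>u i \<in> ultrafilters X\<close>]) auto
      qed
      then have "box (D1 \<union> D2) A \<in> \<B>"
        using B unfolding \<B>_def by blast
      moreover have "box (D1 \<union> D2) A \<subseteq> B1 \<inter> B2"
        unfolding B box_def A_def by auto
      ultimately show ?thesis by blast
    qed
    have P\<B>: "P \<in> \<B>"
    proof -
      \<comment> \<open>Without constraints the box is \<open>P\<close> itself, which makes the base
        nonempty and puts \<open>P\<close> into \<open>q\<close>.\<close>
      have "P = box {} (\<lambda>_. X)"
        by (simp add: box_def)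
      then show ?thesis
        unfolding \<B>_def by blast
    qed
    have sub: "\<B> \<subseteq> Pow (I \<rightarrow>\<^sub>E X)"
      using P unfolding \<B>_def box_def by blast
    obtain q where q: "q \<in> ultrafilters (I \<rightarrow>\<^sub>E X)" "\<B> \<subseteq> q"
      by (rule ultrafilter_extending_base[OF _ sub ne dir]) (use P\<B> in auto)
    have "P \<in> q"
      using q(2) P\<B> by blast
    moreover have "uf_coords I X q = u"
    proof
      fix i
      show "uf_coords I X q i = u i"
      proof (cases "i \<in> I")
        case True
        then have ui: "u i \<in> ultrafilters X"
          using uI by blast
        \<comment> \<open>A box constrained in the single coordinate \<open>i\<close> puts
          \<open>A\<close> into the \<open>i\<close>-th image of \<open>q\<close>; one inclusion
          between ultrafilters is enough.\<close>
        have "u i \<subseteq> uf_map (I \<rightarrow>\<^sub>E X) X (\<lambda>x. x i) q"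
        proof
          fix A assume A: "A \<in> u i"
          then have "box {i} (\<lambda>_. A) \<in> \<B>"
            using True unfolding \<B>_def by blast
          then have "box {i} (\<lambda>_. A) \<in> q"
            using q(2) by blast
          moreover have "box {i} (\<lambda>_. A) \<subseteq> {x \<in> I \<rightarrow>\<^sub>E X. x i \<in> A}"
            using P unfolding box_def by auto
          ultimately have "{x \<in> I \<rightarrow>\<^sub>E X. x i \<in> A} \<in> q"
            by (rule ultrafilter_mono[OF q(1)]) simp
          then show "A \<in> uf_map (I \<rightarrow>\<^sub>E X) X (\<lambda>x. x i) q"
            using ultrafilter_subset[OF ui A] by (simp add: uf_map_def)
        qed
        moreover have "uf_map (I \<rightarrow>\<^sub>E X) X (\<lambda>x. x i) q \<in> ultrafilters X"
          using q(1) True by (intro uf_map_ultrafilter) auto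
        ultimately have "u i = uf_map (I \<rightarrow>\<^sub>E X) X (\<lambda>x. x i) q"
          using ultrafilter_subset_eq[OF ui] by metis
        then show ?thesis
          using True by (simp add: uf_coords_def)
      next
        case False
        then show ?thesis
          using PiE_arb[OF uI False] by (simp add: uf_coords_def)
      qed
    qed
    ultimately show "u \<in> uf_coords I X ` ufs_containing (I \<rightarrow>\<^sub>E X) P"
      using q(1) unfolding ufs_containing_def by blast
  qed
qed

lemma principal_tuples_image:
  "(\<lambda>x. \<lambda>i\<in>I. principal_uf X (x i)) ` (I \<rightarrow>\<^sub>E X) = I \<rightarrow>\<^sub>E principal_uf X ` X"
proof
  show "I \<rightarrow>\<^sub>E principal_uf X ` X \<subseteq> (\<lambda>x. \<lambda>i\<in>I. principal_uf X (x i)) ` (I \<rightarrow>\<^sub>E X)"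
  proof
    fix y assume y: "y \<in> I \<rightarrow>\<^sub>E principal_uf X ` X"
    define x where "x = (\<lambda>i\<in>I. inv_into X (principal_uf X) (y i))"
    have "x \<in> I \<rightarrow>\<^sub>E X"
      using y by (auto simp: x_def PiE_iff intro: inv_into_into)
    moreover have "(\<lambda>i\<in>I. principal_uf X (x i)) = y"
    proof
      show "(\<lambda>i\<in>I. principal_uf X (x i)) i = y i" for i
        using y by (cases "i \<in> I") (auto simp: x_def PiE_iff extensional_def f_inv_into_f)
    qed
    ultimately show "y \<in> (\<lambda>x. \<lambda>i\<in>I. principal_uf X (x i)) ` (I \<rightarrow>\<^sub>E X)"
      by blast
  qed
qed auto

lemma principal_tuples_dense:
  "product_topology (\<lambda>_. beta_top X) I closure_of
    ((\<lambda>x. \<lambda>i\<in>I. principal_uf X (x i)) ` (I \<rightarrow>\<^sub>E X)) = I \<rightarrow>\<^sub>E ultrafilters X"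
  by (simp add: principal_tuples_image closure_of_product_topology principal_ufs_dense)

text \<open>The closure formula with the whole power as \<open>P\<close>: principal tuples are dense
  in the product, so every family of ultrafilters on \<open>X\<close> indexed by \<open>I\<close>
  consists of the coordinates of one ultrafilter. Surjectivity of \<open>e\<close> on operations
  rests on this.\<close>

lemma uf_coords_surj:
  "uf_coords I X ` ultrafilters (I \<rightarrow>\<^sub>E X) = I \<rightarrow>\<^sub>E ultrafilters X"
proof -
  have "ufs_containing (I \<rightarrow>\<^sub>E X) (I \<rightarrow>\<^sub>E X) = ultrafilters (I \<rightarrow>\<^sub>E X)"
    using ultrafilter_carrier by (auto simp: ufs_containing_def)
  then show ?thesis
    using projections_image_eq_closure[of "I \<rightarrow>\<^sub>E X" I X] by (simp add: principal_tuples_dense)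
qed

lemma uf_coords_in:
  "U \<in> ultrafilters (I \<rightarrow>\<^sub>E X) \<Longrightarrow> uf_coords I X U \<in> I \<rightarrow>\<^sub>E ultrafilters X"
  unfolding uf_coords_surj[symmetric] by (rule imageI)

section \<open>Iterated ultrafilter quantifiers\<close>

lemma tuples_fun_upd_Suc: "x \<in> tuples n X \<Longrightarrow> y \<in> X \<Longrightarrow> x(n := y) \<in> tuples (Suc n) X"
  unfolding lessThan_Suc by (rule PiE_fun_upd)

lemma tuples_fun_upd: "v \<in> tuples n S \<Longrightarrow> i < n \<Longrightarrow> u \<in> S \<Longrightarrow> v(i := u) \<in> tuples n S"
  by (auto simp: PiE_iff extensional_def)

lemma uf_all_cong:
  assumes "\<And>x. x \<in> tuples n X \<Longrightarrow> P x = Q x"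
  shows "uf_all X u n P = uf_all X u n Q"
  using assms
proof (induction n arbitrary: P Q)
  case (Suc n)
  have eq: "{y \<in> X. P (x(n := y))} = {y \<in> X. Q (x(n := y))}" if "x \<in> tuples n X" for x
    using Suc.prems tuples_fun_upd_Suc[OF that] by blast
  have "uf_all X u n (\<lambda>x. {y \<in> X. P (x(n := y))} \<in> u n) =
      uf_all X u n (\<lambda>x. {y \<in> X. Q (x(n := y))} \<in> u n)"
    by (rule Suc.IH) (simp only: eq)
  then show ?case by simp
qed simp

lemma uf_all_True:
  "(\<And>i. i < n \<Longrightarrow> u i \<in> ultrafilters X) \<Longrightarrow> uf_all X u n (\<lambda>_. True)"
  by (induction n) (simp_all add: ultrafilter_carrier)

text \<open>Each ultrafilter quantifier commutes with conjunction, so the iterated one does too; the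
  same holds below for negation.\<close>

lemma uf_all_conj:
  assumes "\<And>i. i < n \<Longrightarrow> u i \<in> ultrafilters X"
  shows "uf_all X u n (\<lambda>x. P x \<and> Q x) \<longleftrightarrow> uf_all X u n P \<and> uf_all X u n Q"
  using assms by (induction n arbitrary: P Q) (simp_all add: ultrafilter_Collect_conj)

lemma uf_all_not:
  assumes "\<And>i. i < n \<Longrightarrow> u i \<in> ultrafilters X"
  shows "uf_all X u n (\<lambda>x. \<not> P x) \<longleftrightarrow> \<not> uf_all X u n P"
  using assms by (induction n arbitrary: P) (simp_all add: ultrafilter_Collect_not)

text \<open>A quantifier over a principal ultrafilter is evaluation at its point.\<close>

lemma uf_all_principal:
  assumes "a \<in> tuples n X" "\<And>i. i < n \<Longrightarrow> u i = principal_uf X (a i)"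
  shows "uf_all X u n P \<longleftrightarrow> P a"
  using assms
proof (induction n arbitrary: a P)
  case 0
  then show ?case by simp
next
  case (Suc n)
  \<comment> \<open>Tuples are extensional, so dropping the last coordinate has to reset it to
    \<open>undefined\<close> before the induction hypothesis applies.\<close>
  define b where "b = restrict a {..<n}"
  have "b \<in> tuples n X" "a n \<in> X"
    using Suc.prems(1) by (auto simp: b_def PiE_iff)
  moreover have "b(n := a n) = a"
  proof
    show "(b(n := a n)) i = a i" for i
      using Suc.prems(1) by (auto simp: b_def PiE_iff extensional_def)
  qed
  moreover have "uf_all X u n Q \<longleftrightarrow> Q b" for Q
    by (rule Suc.IH[OF \<open>b \<in> tuples n X\<close>]) (simp add: b_def Suc.prems(2))
  ultimately show ?case
    using Suc.prems(2)[of n] by (simp add: principal_uf_def)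
qed

text \<open>The source of right continuity: quantifiers left of \<open>i\<close> are evaluations,
  and those right of \<open>i\<close> belong to a predicate independent of \<open>u\<close>. What
  remains is membership of one fixed set in \<open>u\<close>, a basic clopen condition.\<close>

lemma uf_all_section:
  assumes "i < n" "\<And>j. j < i \<Longrightarrow> v j \<in> principal_uf X ` X"
  obtains B where "B \<subseteq> X" "\<And>u. uf_all X (v(i := u)) n P \<longleftrightarrow> B \<in> u"
proof -
  have "\<exists>B\<subseteq>X. \<forall>u. uf_all X (v(i := u)) n P \<longleftrightarrow> B \<in> u"
    using assms
  proof (induction n arbitrary: P)
    case (Suc n)
    show ?case
    proof (cases "i < n")
      \<comment> \<open>The innermost quantifier is over \<open>v n\<close>, which \<open>u\<close>
        does not affect; the induction hypothesis, stated for arbitrary predicates, absorbs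
        it.\<close>
      case True
      then show ?thesis
        using Suc.IH[OF True Suc.prems(2)] by simp
    next
      case False
      \<comment> \<open>Now \<open>u\<close> is the innermost quantifier and all outer ones are
        principal, with points \<open>a j\<close>.\<close>
      then have "i = n"
        using Suc.prems(1) by simp
      define a where "a = (\<lambda>j\<in>{..<n}. inv_into X (principal_uf X) (v j))"
      have a: "v j = principal_uf X (a j)" if "j < n" for j
        using Suc.prems(2) that \<open>i = n\<close> by (simp add: a_def f_inv_into_f)
      have "a \<in> tuples n X"
        using Suc.prems(2) \<open>i = n\<close> by (auto simp: a_def intro!: inv_into_into)
      then have "uf_all X (v(n := u)) n Q \<longleftrightarrow> Q a" for u Q
        using a by (intro uf_all_principal) auto
      then have B: "uf_all X (v(i := u)) (Suc n) P \<longleftrightarrow> {y \<in> X. P (a(n := y))} \<in> u" for u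
        using \<open>i = n\<close> by simp
      show ?thesis
      proof (intro exI conjI allI)
        show "{y \<in> X. P (a(n := y))} \<subseteq> X"
          by blast
      qed (fact B)
    qed
  qed simp
  then show ?thesis
    using that by blast
qed

section \<open>Right continuous operations\<close>

lemma principal_tuple_in_tuples:
  "x \<in> tuples n X \<Longrightarrow> principal_tuple n X x \<in> tuples n (ultrafilters X)"
  by (auto simp: principal_tuple_def intro!: principal_ultrafilter)

text \<open>The iterated limit of \<open>h\<close> along \<open>u 0\<close>, ...,
  \<open>u (n-1)\<close>, written with ultrafilter quantifiers. It generalizes
  \<open>tilde_fun\<close> to values in \<beta>X, because the coordinates of an ultrafilter over
  operations may be nonprincipal.\<close>

definition lift_op ::
  "nat \<Rightarrow> 'a set \<Rightarrow> ((nat \<Rightarrow> 'a) \<Rightarrow> 'a set set) \<Rightarrow> (nat \<Rightarrow> 'a set set) \<Rightarrow> 'a set set" where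
  "lift_op n X h =
     (\<lambda>u\<in>tuples n (ultrafilters X). {A. A \<subseteq> X \<and> uf_all X u n (\<lambda>x. A \<in> h x)})"

lemma lift_op_cong:
  assumes "\<And>x. x \<in> tuples n X \<Longrightarrow> h x = k x"
  shows "lift_op n X h = lift_op n X k"
  unfolding lift_op_def
  by (intro restrict_ext Collect_cong conj_cong refl uf_all_cong) (simp add: assms)

lemma tilde_fun_eq_lift_op:
  "tilde_fun n X f = lift_op n X (\<lambda>x. principal_uf X (f x))"
  unfolding tilde_fun_def lift_op_def
  by (intro restrict_ext Collect_cong conj_cong refl uf_all_cong) (simp add: principal_uf_def)

lemma lift_op_ultrafilter:
  assumes h: "h \<in> tuples n X \<rightarrow> ultrafilters X" and u: "u \<in> tuples n (ultrafilters X)"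
  shows "lift_op n X h u \<in> ultrafilters X"
proof (rule ultrafiltersI)
  have hx: "h x \<in> ultrafilters X" if "x \<in> tuples n X" for x
    using h that by blast
  have ui: "u i \<in> ultrafilters X" if "i < n" for i
    using u that by blast
  have mem: "A \<in> lift_op n X h u \<longleftrightarrow> A \<subseteq> X \<and> uf_all X u n (\<lambda>x. A \<in> h x)" for A
    using u by (simp add: lift_op_def)
  show "lift_op n X h u \<subseteq> Pow X"
    using mem by blast
  have "uf_all X u n (\<lambda>x. X \<in> h x) = uf_all X u n (\<lambda>x. True)"
    by (rule uf_all_cong) (simp add: hx ultrafilter_carrier)
  then show "X \<in> lift_op n X h u"
    using uf_all_True[OF ui] by (simp add: mem)
  show "X - A \<in> lift_op n X h u \<longleftrightarrow> A \<notin> lift_op n X h u" if "A \<subseteq> X" for A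
  proof -
    have "uf_all X u n (\<lambda>x. X - A \<in> h x) = uf_all X u n (\<lambda>x. \<not> A \<in> h x)"
      by (rule uf_all_cong) (simp add: ultrafilter_Diff_iff[OF hx that])
    then show ?thesis
      using that uf_all_not[OF ui] by (simp add: mem)
  qed
  show "A \<inter> B \<in> lift_op n X h u \<longleftrightarrow> A \<in> lift_op n X h u \<and> B \<in> lift_op n X h u"
    if "A \<subseteq> X" "B \<subseteq> X" for A B
  proof -
    have "uf_all X u n (\<lambda>x. A \<inter> B \<in> h x) = uf_all X u n (\<lambda>x. A \<in> h x \<and> B \<in> h x)"
      by (rule uf_all_cong) (simp add: ultrafilter_Int_iff[OF hx that])
    then show ?thesis
      using that uf_all_conj[OF ui] by (auto simp add: mem)
  qed
qed

lemma lift_op_principal: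
  assumes "x \<in> tuples n X" "h x \<in> ultrafilters X"
  shows "lift_op n X h (principal_tuple n X x) = h x"
proof -
  have "uf_all X (principal_tuple n X x) n P \<longleftrightarrow> P x" for P
    using assms(1) by (rule uf_all_principal) (simp add: principal_tuple_def)
  moreover have "{A. A \<subseteq> X \<and> A \<in> h x} = h x"
    using ultrafilter_subset[OF assms(2)] by blast
  ultimately show ?thesis
    using principal_tuple_in_tuples[OF assms(1)] by (simp add: lift_op_def)
qed

text \<open>By \<open>uf_all_section\<close>, the preimage of a basic set under a section is again a
  basic set.\<close>

lemma lift_op_in_rc_ops:
  assumes h: "h \<in> tuples n X \<rightarrow> ultrafilters X"
  shows "lift_op n X h \<in> rc_ops n X (beta_top X)"
proof -
  have "right_continuous n X (beta_top X) (lift_op n X h)"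
    unfolding right_continuous_def
  proof (intro allI ballI impI)
    fix i v assume iv: "i < n" "v \<in> tuples n (ultrafilters X)" "\<forall>j<i. v j \<in> principal_uf X ` X"
    show "continuous_map (beta_top X) (beta_top X) (\<lambda>u. lift_op n X h (v(i := u)))"
    proof (rule continuous_map_into_beta_top)
      show "lift_op n X h (v(i := u)) \<in> ultrafilters X" if "u \<in> topspace (beta_top X)" for u
        using that iv tuples_fun_upd[of v n _ i u] by (intro lift_op_ultrafilter[OF h]) simp
      fix A assume "A \<subseteq> X"
      obtain B where "B \<subseteq> X" and B: "\<And>u. uf_all X (v(i := u)) n (\<lambda>x. A \<in> h x) \<longleftrightarrow> B \<in> u"
        using uf_all_section[OF iv(1), of v X] iv(3) by metis
      have "A \<in> lift_op n X h (v(i := u)) \<longleftrightarrow> B \<in> u" if "u \<in> ultrafilters X" for u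
        unfolding lift_op_def restrict_apply'[OF tuples_fun_upd[OF iv(2,1) that]]
        using \<open>A \<subseteq> X\<close> B by simp
      then have "{u \<in> topspace (beta_top X). A \<in> lift_op n X h (v(i := u))} = ufs_containing X B"
        by (auto simp: ufs_containing_def)
      then show "openin (beta_top X) {u \<in> topspace (beta_top X). A \<in> lift_op n X h (v(i := u))}"
        using openin_ufs_containing[OF \<open>B \<subseteq> X\<close>] by simp
    qed
  qed
  moreover have "lift_op n X h \<in> tuples n (ultrafilters X) \<rightarrow>\<^sub>E ultrafilters X"
    using lift_op_ultrafilter[OF h] by (auto simp: lift_op_def)
  ultimately show ?thesis
    by (simp add: rc_ops_def)
qed

text \<open>Nonprincipal coordinates are admitted one at a time from the right, each by density of \<open>X\<close>
  in \<open>\<beta>X\<close>.\<close>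

lemma right_continuous_determined:
  assumes T: "Hausdorff_space T"
    and g: "right_continuous n X T g" and k: "right_continuous n X T k"
    and eq: "\<And>x. x \<in> tuples n X \<Longrightarrow> g (principal_tuple n X x) = k (principal_tuple n X x)"
    and u: "u \<in> tuples n (ultrafilters X)"
  shows "g u = k u"
proof -
  \<comment> \<open>Here \<open>m\<close> counts the coordinates at the right end that may be
    nonprincipal; \<open>m = n\<close> leaves all of them free.\<close>
  have "g v = k v"
    if "m \<le> n" "v \<in> tuples n (ultrafilters X)" "\<And>j. j < n - m \<Longrightarrow> v j \<in> principal_uf X ` X" for m v
    using that
  proof (induction m arbitrary: v)
    case 0
    then have "v \<in> tuples n (principal_uf X ` X)"
      by (auto simp: PiE_iff)
    then obtain x where "x \<in> tuples n X" "v = principal_tuple n X x"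
      unfolding principal_tuples_image[symmetric] principal_tuple_def by blast
    then show ?case
      using eq by simp
  next
    case (Suc m)
    define i where "i = n - Suc m"
    have i: "i < n" "n - m = Suc i"
      using Suc.prems(1) by (auto simp: i_def)
    have vi: "v i \<in> ultrafilters X"
      using Suc.prems(2) i(1) by blast
    have pr: "\<forall>j<i. v j \<in> principal_uf X ` X"
      using Suc.prems(3) by (simp add: i_def)
    have "g (v(i := w)) = k (v(i := w))" if "w \<in> ultrafilters X" for w
    proof (rule forall_in_closure_of_eq[where f = "\<lambda>w. g (v(i := w))" and g = "\<lambda>w. k (v(i := w))"])
      show "w \<in> beta_top X closure_of (principal_uf X ` X)"
        using that by (simp add: principal_ufs_dense)
      show "continuous_map (beta_top X) T (\<lambda>w. g (v(i := w)))"
        using g i(1) Suc.prems(2) pr unfolding right_continuous_def by blast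
      show "continuous_map (beta_top X) T (\<lambda>w. k (v(i := w)))"
        using k i(1) Suc.prems(2) pr unfolding right_continuous_def by blast
      fix w assume w: "w \<in> principal_uf X ` X"
      show "g (v(i := w)) = k (v(i := w))"
      proof (rule Suc.IH)
        show "v(i := w) \<in> tuples n (ultrafilters X)"
          using Suc.prems(2) i(1) w principal_ultrafilter by (intro tuples_fun_upd) auto
        show "(v(i := w)) j \<in> principal_uf X ` X" if "j < n - m" for j
          using that i(2) pr w by (cases "j = i") auto
      qed (use Suc.prems(1) in simp)
    qed (fact T)
    from this[OF vi] show ?case by simp
  qed
  from this[of n u] show ?thesis
    using u by simp
qed

section \<open>Pointwise convergence on X^n and the map \<open>e\<close> on operations\<close>

lemma Hausdorff_space_pullback_topology:
  assumes "Hausdorff_space T" "inj_on f (f -` topspace T \<inter> A)"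
  shows "Hausdorff_space (pullback_topology A f T)"
  unfolding Hausdorff_space_def topspace_pullback_topology
proof (intro allI impI, elim conjE)
  fix x y assume xy: "x \<in> f -` topspace T \<inter> A" "y \<in> f -` topspace T \<inter> A" "x \<noteq> y"
  then have "f x \<noteq> f y"
    using assms(2) by (auto dest: inj_onD)
  moreover have "f x \<in> topspace T" "f y \<in> topspace T"
    using xy(1,2) by simp_all
  ultimately obtain U V where UV: "openin T U" "openin T V" "f x \<in> U" "f y \<in> V" "disjnt U V"
    using assms(1)[unfolded Hausdorff_space_def, rule_format, of "f x" "f y"] by blast
  show "\<exists>U V. openin (pullback_topology A f T) U \<and> openin (pullback_topology A f T) V \<and>
      x \<in> U \<and> y \<in> V \<and> disjnt U V"
  proof (intro exI conjI)
    show "openin (pullback_topology A f T) (f -` U \<inter> A)" "openin (pullback_topology A f T) (f -` V \<inter> A)"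
      using UV(1,2) by (auto simp: openin_pullback_topology)
  qed (use UV(3-5) xy in \<open>auto simp: disjnt_iff\<close>)
qed

lemma rc_ops_eqI:
  assumes "Hausdorff_space T" and gk: "g \<in> rc_ops n X T" "k \<in> rc_ops n X T"
    and "\<And>x. x \<in> tuples n X \<Longrightarrow> g (principal_tuple n X x) = k (principal_tuple n X x)"
  shows "g = k"
proof (rule PiE_ext)
  show "g \<in> tuples n (ultrafilters X) \<rightarrow>\<^sub>E topspace T" "k \<in> tuples n (ultrafilters X) \<rightarrow>\<^sub>E topspace T"
    using gk by (simp_all add: rc_ops_def)
  have rc: "right_continuous n X T g" "right_continuous n X T k"
    using gk by (simp_all add: rc_ops_def)
  show "g u = k u" if "u \<in> tuples n (ultrafilters X)" for u
    by (rule right_continuous_determined[OF assms(1) rc assms(4) that])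
qed

text \<open>Restriction to X^n is injective on right continuous operations, so the Hausdorff
  property of the power pulls back. This gives uniqueness of the extension that defines
  \<open>e\<close>.\<close>

lemma Hausdorff_rc_top:
  assumes "Hausdorff_space T"
  shows "Hausdorff_space (rc_top n X T)"
  unfolding rc_top_def
proof (rule Hausdorff_space_pullback_topology)
  show "Hausdorff_space (product_topology (\<lambda>_. T) (tuples n X))"
    using assms by (simp add: Hausdorff_space_product_topology)
  show "inj_on (\<lambda>g. \<lambda>x\<in>tuples n X. g (principal_tuple n X x))
      ((\<lambda>g. \<lambda>x\<in>tuples n X. g (principal_tuple n X x)) -`
        topspace (product_topology (\<lambda>_. T) (tuples n X)) \<inter> rc_ops n X T)"
  proof (rule inj_onI, rule rc_ops_eqI[OF assms])
    fix g k x assume gk: "(\<lambda>x\<in>tuples n X. g (principal_tuple n X x)) =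
        (\<lambda>x\<in>tuples n X. k (principal_tuple n X x))" and x: "x \<in> tuples n X"
    show "g (principal_tuple n X x) = k (principal_tuple n X x)"
      using fun_cong[OF gk, of x] unfolding restrict_apply'[OF x] .
  qed auto
qed

lemma continuous_map_into_rc_top:
  assumes "\<And>u. u \<in> topspace S \<Longrightarrow> g u \<in> rc_ops n X T"
    and "\<And>x. x \<in> tuples n X \<Longrightarrow> continuous_map S T (\<lambda>u. g u (principal_tuple n X x))"
  shows "continuous_map S (rc_top n X T) g"
  unfolding rc_top_def
proof (rule continuous_map_pullback')
  show "continuous_map S (product_topology (\<lambda>_. T) (tuples n X))
      ((\<lambda>g. \<lambda>x\<in>tuples n X. g (principal_tuple n X x)) \<circ> g)"
    unfolding continuous_map_componentwise comp_def
  proof (intro conjI ballI)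
    fix x assume x: "x \<in> tuples n X"
    show "continuous_map S T (\<lambda>u. (\<lambda>x\<in>tuples n X. g u (principal_tuple n X x)) x)"
      unfolding restrict_apply'[OF x] by (rule assms(2)[OF x])
  qed (simp add: image_subset_iff)
qed (use assms(1) in auto)

text \<open>Uniqueness of the extension leaves two checks. Continuity in \<open>U\<close> is tested
  at principal tuples, where \<open>lift_op\<close> returns a coordinate of \<open>U\<close>. For
  \<open>U\<close> principal at \<open>f\<close>, the coordinates are the principal ultrafilters at
  the values of \<open>f\<close>, whose lift is \<open>tilde_fun\<close>.\<close>

lemma e_fun_eq:
  assumes "U \<in> ultrafilters (tuples n X \<rightarrow>\<^sub>E X)"
  shows "e_fun n X U = lift_op n X (uf_coords (tuples n X) X U)"
  unfolding e_fun_def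
proof (rule beta_ext_eq[where g = "\<lambda>U. lift_op n X (uf_coords (tuples n X) X U)"])
  show "continuous_map (beta_top (tuples n X \<rightarrow>\<^sub>E X)) (rc_top n X (beta_top X))
      (\<lambda>U. lift_op n X (uf_coords (tuples n X) X U))"
  proof (rule continuous_map_into_rc_top)
    show "lift_op n X (uf_coords (tuples n X) X U) \<in> rc_ops n X (beta_top X)"
      if "U \<in> topspace (beta_top (tuples n X \<rightarrow>\<^sub>E X))" for U
      using uf_coords_in[of U "tuples n X" X] that by (intro lift_op_in_rc_ops) (simp add: PiE_iff)
    fix x assume x: "x \<in> tuples n X"
    have eq: "lift_op n X (uf_coords (tuples n X) X U) (principal_tuple n X x) = uf_coords (tuples n X) X U x"
      if "U \<in> ultrafilters (tuples n X \<rightarrow>\<^sub>E X)" for U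
      using PiE_mem[OF uf_coords_in[OF that] x] by (rule lift_op_principal[OF x])
    have "continuous_map (beta_top (tuples n X \<rightarrow>\<^sub>E X)) (beta_top X)
        (\<lambda>U. uf_coords (tuples n X) X U x)"
      by (rule continuous_map_uf_coord[OF x])
    then show "continuous_map (beta_top (tuples n X \<rightarrow>\<^sub>E X)) (beta_top X)
        (\<lambda>U. lift_op n X (uf_coords (tuples n X) X U) (principal_tuple n X x))"
      by (rule continuous_map_eq) (simp only: topspace_beta_top eq)
  qed
  fix f assume "f \<in> tuples n X \<rightarrow>\<^sub>E X"
  then show "lift_op n X (uf_coords (tuples n X) X (principal_uf (tuples n X \<rightarrow>\<^sub>E X) f)) = tilde_fun n X f"
    unfolding tilde_fun_eq_lift_op by (intro lift_op_cong) (simp add: uf_coords_def uf_map_principal)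
qed (fact assms Hausdorff_rc_top[OF Hausdorff_beta_top])+

text \<open>For surjectivity, \<open>uf_coords_surj\<close> realizes the values of \<open>g\<close>
  on X^n as the coordinates of an ultrafilter; their lift agrees with \<open>g\<close> on X^n, hence
  everywhere.\<close>

lemma e_fun_image:
  "e_fun n X ` ultrafilters (tuples n X \<rightarrow>\<^sub>E X) = rc_ops n X (beta_top X)"
proof (intro equalityI subsetI)
  fix g assume "g \<in> e_fun n X ` ultrafilters (tuples n X \<rightarrow>\<^sub>E X)"
  then obtain U where U: "U \<in> ultrafilters (tuples n X \<rightarrow>\<^sub>E X)" "g = e_fun n X U"
    by blast
  show "g \<in> rc_ops n X (beta_top X)"
    unfolding U(2) e_fun_eq[OF U(1)]
    using uf_coords_in[OF U(1)] by (intro lift_op_in_rc_ops) (simp add: PiE_iff)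
next
  fix g assume g: "g \<in> rc_ops n X (beta_top X)"
  define h where "h = (\<lambda>x\<in>tuples n X. g (principal_tuple n X x))"
  have "g \<in> tuples n (ultrafilters X) \<rightarrow>\<^sub>E ultrafilters X"
    using g by (simp add: rc_ops_def)
  then have hx: "h x \<in> ultrafilters X" if "x \<in> tuples n X" for x
    unfolding h_def restrict_apply'[OF that] using principal_tuple_in_tuples[OF that] by (rule PiE_mem)
  have "h \<in> tuples n X \<rightarrow>\<^sub>E ultrafilters X"
    by (rule PiE_I[OF hx]) (simp_all add: h_def)
  then have "h \<in> uf_coords (tuples n X) X ` ultrafilters (tuples n X \<rightarrow>\<^sub>E X)"
    unfolding uf_coords_surj .
  then obtain U where U: "U \<in> ultrafilters (tuples n X \<rightarrow>\<^sub>E X)" "h = uf_coords (tuples n X) X U"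
    by blast
  have "lift_op n X h = g"
  proof (rule rc_ops_eqI[OF Hausdorff_beta_top _ g])
    show "lift_op n X h \<in> rc_ops n X (beta_top X)"
      by (intro lift_op_in_rc_ops Pi_I hx)
    show "lift_op n X h (principal_tuple n X x) = g (principal_tuple n X x)" if "x \<in> tuples n X" for x
      using lift_op_principal[OF that] hx[OF that] that by (simp add: h_def)
  qed
  then have "e_fun n X U = g"
    by (simp add: e_fun_eq[OF U(1)] U(2)[symmetric])
  then show "g \<in> e_fun n X ` ultrafilters (tuples n X \<rightarrow>\<^sub>E X)"
    using U(1) by blast
qed

section \<open>Right clopen relations\<close>

lemma continuous_map_into_bool:
  assumes "openin T {x \<in> topspace T. P x}" "closedin T {x \<in> topspace T. P x}"
  shows "continuous_map T (discrete_topology (UNIV :: bool set)) P"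
  unfolding continuous_map_alt
proof (intro conjI strip)
  fix W :: "bool set"
  have mem: "P x \<in> W \<longleftrightarrow> P x \<and> True \<in> W \<or> \<not> P x \<and> False \<in> W" for x
    by (cases "P x") simp_all
  have eq: "P -` W \<inter> topspace T =
      {x \<in> topspace T. P x \<and> True \<in> W} \<union> {x \<in> topspace T. \<not> P x \<and> False \<in> W}"
    by (rule set_eqI) (simp only: Int_iff vimage_eq Un_iff mem_Collect_eq mem, blast)
  have "topspace T - {x \<in> topspace T. P x} = {x \<in> topspace T. \<not> P x}"
    by blast
  then have "openin T {x \<in> topspace T. \<not> P x}"
    using openin_diff[OF openin_topspace assms(2)] by (simp only:)
  then have "openin T {x \<in> topspace T. P x \<and> True \<in> W}" "openin T {x \<in> topspace T. \<not> P x \<and> False \<in> W}"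
    using assms(1) by (cases "True \<in> W"; cases "False \<in> W"; simp)+
  then show "openin T (P -` W \<inter> topspace T)"
    unfolding eq by (rule openin_Un)
qed simp

definition char_fun ::
  "nat \<Rightarrow> 'a set \<Rightarrow> (nat \<Rightarrow> 'a set set) set \<Rightarrow> (nat \<Rightarrow> 'a set set) \<Rightarrow> bool" where
  "char_fun n X Q = (\<lambda>u\<in>tuples n (ultrafilters X). u \<in> Q)"

lemma char_fun_apply: "u \<in> tuples n (ultrafilters X) \<Longrightarrow> char_fun n X Q u \<longleftrightarrow> u \<in> Q"
  by (simp add: char_fun_def)

lemma inj_on_char_fun: "inj_on (char_fun n X) (Pow (tuples n (ultrafilters X)))"
proof (rule inj_on_inverseI[where g = "\<lambda>f. {u \<in> tuples n (ultrafilters X). f u}"])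
  fix Q assume "Q \<in> Pow (tuples n (ultrafilters X))"
  moreover have "{u \<in> tuples n (ultrafilters X). char_fun n X Q u} = tuples n (ultrafilters X) \<inter> Q"
    by (simp add: char_fun_apply set_eq_iff cong: conj_cong)
  ultimately show "{u \<in> tuples n (ultrafilters X). char_fun n X Q u} = Q"
    by blast
qed

text \<open>A clopen section is a continuous map into discrete \<open>bool\<close>, so the facts
  about right continuous operations carry over to relations.\<close>

lemma char_fun_in_rc_ops:
  assumes "right_clopen n X Q"
  shows "char_fun n X Q \<in> rc_ops n X (discrete_topology UNIV)"
proof -
  have "right_continuous n X (discrete_topology UNIV) (char_fun n X Q)"
    unfolding right_continuous_def
  proof (intro allI ballI impI)
    fix i v assume iv: "i < n" "v \<in> tuples n (ultrafilters X)" "\<forall>j<i. v j \<in> principal_uf X ` X"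
    have "continuous_map (beta_top X) (discrete_topology UNIV) (\<lambda>u. v(i := u) \<in> Q)"
      using assms iv by (intro continuous_map_into_bool) (simp_all add: right_clopen_def)
    then show "continuous_map (beta_top X) (discrete_topology UNIV) (\<lambda>u. char_fun n X Q (v(i := u)))"
    proof (rule continuous_map_eq)
      fix u assume "u \<in> topspace (beta_top X)"
      then have "v(i := u) \<in> tuples n (ultrafilters X)"
        using iv(1,2) tuples_fun_upd by auto
      then show "(v(i := u) \<in> Q) = char_fun n X Q (v(i := u))"
        by (rule char_fun_apply[symmetric])
    qed
  qed
  moreover have "char_fun n X Q \<in> tuples n (ultrafilters X) \<rightarrow>\<^sub>E UNIV"
    by (simp add: char_fun_def)
  ultimately show ?thesis
    by (simp add: rc_ops_def)
qed

lemma right_clopen_eqI: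
  assumes "right_clopen n X Q" "right_clopen n X R"
    and sub: "Q \<subseteq> tuples n (ultrafilters X)" "R \<subseteq> tuples n (ultrafilters X)"
    and eq: "\<And>x. x \<in> tuples n X \<Longrightarrow> principal_tuple n X x \<in> Q \<longleftrightarrow> principal_tuple n X x \<in> R"
  shows "Q = R"
proof -
  have "char_fun n X Q = char_fun n X R"
  proof (rule rc_ops_eqI)
    show "Hausdorff_space (discrete_topology (UNIV :: bool set))"
      by simp
    show "char_fun n X Q (principal_tuple n X x) = char_fun n X R (principal_tuple n X x)"
      if "x \<in> tuples n X" for x
      using char_fun_apply[OF principal_tuple_in_tuples[OF that]] eq[OF that] by metis
  qed (rule char_fun_in_rc_ops; fact)+
  then show ?thesis
    by (rule inj_onD[OF inj_on_char_fun]) (rule PowI, fact sub)+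
qed

lemma rc_rel_top_eq:
  "rc_rel_top n X = pullback_topology {Q. Q \<subseteq> tuples n (ultrafilters X) \<and> right_clopen n X Q}
     (char_fun n X) (rc_top n X (discrete_topology UNIV))"
  unfolding rc_rel_top_def char_fun_def ..

lemma Hausdorff_rc_rel_top: "Hausdorff_space (rc_rel_top n X)"
  unfolding rc_rel_top_eq
proof (rule Hausdorff_space_pullback_topology)
  show "Hausdorff_space (rc_top n X (discrete_topology (UNIV :: bool set)))"
    by (rule Hausdorff_rc_top) simp
qed (rule inj_on_subset[OF inj_on_char_fun], blast)

lemma tilde_rel_principal:
  assumes "x \<in> tuples n X"
  shows "principal_tuple n X x \<in> tilde_rel n X P \<longleftrightarrow> x \<in> P"
proof -
  have "uf_all X (principal_tuple n X x) n (\<lambda>x. x \<in> P) \<longleftrightarrow> x \<in> P"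
    using assms by (rule uf_all_principal) (simp add: principal_tuple_def)
  then show ?thesis
    using principal_tuple_in_tuples[OF assms] by (simp add: tilde_rel_def)
qed

lemma tilde_rel_subset: "tilde_rel n X P \<subseteq> tuples n (ultrafilters X)"
  unfolding tilde_rel_def by blast

lemma right_clopen_tilde_rel: "right_clopen n X (tilde_rel n X P)"
  unfolding right_clopen_def
proof (intro allI ballI impI)
  fix i v assume iv: "i < n" "v \<in> tuples n (ultrafilters X)" "\<forall>j<i. v j \<in> principal_uf X ` X"
  obtain B where "B \<subseteq> X" and B: "\<And>u. uf_all X (v(i := u)) n (\<lambda>x. x \<in> P) \<longleftrightarrow> B \<in> u"
    using uf_all_section[OF iv(1), of v X] iv(3) by metis
  have "v(i := u) \<in> tilde_rel n X P \<longleftrightarrow> B \<in> u" if "u \<in> ultrafilters X" for u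
    using tuples_fun_upd[OF iv(2,1) that] unfolding tilde_rel_def by (simp only: mem_Collect_eq B simp_thms)
  then have "{u \<in> ultrafilters X. v(i := u) \<in> tilde_rel n X P} = ufs_containing X B"
    unfolding ufs_containing_def by blast
  then show "openin (beta_top X) {u \<in> ultrafilters X. v(i := u) \<in> tilde_rel n X P} \<and>
      closedin (beta_top X) {u \<in> ultrafilters X. v(i := u) \<in> tilde_rel n X P}"
    using openin_ufs_containing[OF \<open>B \<subseteq> X\<close>] closedin_ufs_containing[OF \<open>B \<subseteq> X\<close>] by simp
qed

text \<open>The limit along \<open>r\<close> in the Cantor cube of subsets of \<open>S\<close>; \<open>e(r)\<close> depends only on it.\<close>

definition limit_set :: "'a set \<Rightarrow> 'a set set set \<Rightarrow> 'a set" where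
  "limit_set S r = {x \<in> S. {Q. Q \<subseteq> S \<and> x \<in> Q} \<in> r}"

lemma limit_set_subset: "limit_set S r \<subseteq> S"
  unfolding limit_set_def by blast

lemma limit_set_principal: "P \<subseteq> S \<Longrightarrow> limit_set S (principal_uf (Pow S) P) = P"
  by (auto simp: limit_set_def principal_uf_def)

text \<open>The value at the principal tuple of \<open>x\<close> is the condition that the relations
  containing \<open>x\<close> form a member of \<open>r\<close>. It is a basic clopen condition on
  \<open>r\<close>, which gives continuity; uniqueness of the extension does the rest.\<close>

lemma e_rel_eq:
  assumes "r \<in> ultrafilters (Pow (tuples n X))"
  shows "e_rel n X r = tilde_rel n X (limit_set (tuples n X) r)"
  unfolding e_rel_def
proof (rule beta_ext_eq[where g = "\<lambda>r. tilde_rel n X (limit_set (tuples n X) r)"])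
  show "continuous_map (beta_top (Pow (tuples n X))) (rc_rel_top n X)
      (\<lambda>r. tilde_rel n X (limit_set (tuples n X) r))"
    unfolding rc_rel_top_eq
  proof (rule continuous_map_pullback')
    show "continuous_map (beta_top (Pow (tuples n X))) (rc_top n X (discrete_topology UNIV))
        (char_fun n X \<circ> (\<lambda>r. tilde_rel n X (limit_set (tuples n X) r)))"
      unfolding comp_def
    proof (rule continuous_map_into_rc_top)
      fix x assume x: "x \<in> tuples n X"
      let ?B = "{Q. Q \<subseteq> tuples n X \<and> x \<in> Q}"
      have "char_fun n X (tilde_rel n X (limit_set (tuples n X) r)) (principal_tuple n X x) \<longleftrightarrow> ?B \<in> r" for r
        unfolding char_fun_apply[OF principal_tuple_in_tuples[OF x]] tilde_rel_principal[OF x]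
        using x by (simp add: limit_set_def)
      moreover have "?B \<subseteq> Pow (tuples n X)"
        by blast
      then have "continuous_map (beta_top (Pow (tuples n X))) (discrete_topology UNIV) (\<lambda>r. ?B \<in> r)"
        using openin_ufs_containing[of ?B "Pow (tuples n X)"] closedin_ufs_containing[of ?B "Pow (tuples n X)"]
        by (intro continuous_map_into_bool) (simp_all add: ufs_containing_def)
      ultimately show "continuous_map (beta_top (Pow (tuples n X))) (discrete_topology UNIV)
          (\<lambda>r. char_fun n X (tilde_rel n X (limit_set (tuples n X) r)) (principal_tuple n X x))"
        by simp
    qed (rule char_fun_in_rc_ops[OF right_clopen_tilde_rel])
  qed (rule subsetI, simp add: right_clopen_tilde_rel tilde_rel_subset)
  fix P assume "P \<in> Pow (tuples n X)"
  then show "tilde_rel n X (limit_set (tuples n X) (principal_uf (Pow (tuples n X)) P)) = tilde_rel n X P"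
    by (simp add: limit_set_principal)
qed (fact assms Hausdorff_rc_rel_top)+

lemma limit_set_image: "limit_set S ` ultrafilters (Pow S) = Pow S"
proof
  show "limit_set S ` ultrafilters (Pow S) \<subseteq> Pow S"
    by (intro image_subsetI PowI limit_set_subset)
  show "Pow S \<subseteq> limit_set S ` ultrafilters (Pow S)"
  proof
    fix P assume P: "P \<in> Pow S"
    then have "P = limit_set S (principal_uf (Pow S) P)"
      by (simp add: limit_set_principal)
    then show "P \<in> limit_set S ` ultrafilters (Pow S)"
      using principal_ultrafilter[OF P] by (rule image_eqI)
  qed
qed

text \<open>Relations take only two values at each tuple, so the trace of a right clopen
  \<open>Q\<close> on X^n is an ordinary relation, and its extension is \<open>Q\<close>
  again.\<close>

lemma e_rel_image:
  "e_rel n X ` ultrafilters (Pow (tuples n X)) =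
    {Q. Q \<subseteq> tuples n (ultrafilters X) \<and> right_clopen n X Q}"
proof -
  have "Q \<in> tilde_rel n X ` Pow (tuples n X)"
    if Q: "Q \<subseteq> tuples n (ultrafilters X)" "right_clopen n X Q" for Q
  proof -
    have "Q = tilde_rel n X {x \<in> tuples n X. principal_tuple n X x \<in> Q}"
      by (rule right_clopen_eqI[OF Q(2) right_clopen_tilde_rel Q(1) tilde_rel_subset])
        (simp add: tilde_rel_principal)
    then show ?thesis by blast
  qed
  then have "{Q. Q \<subseteq> tuples n (ultrafilters X) \<and> right_clopen n X Q} \<subseteq> tilde_rel n X ` Pow (tuples n X)"
    by (intro subsetI) simp
  moreover have "tilde_rel n X ` Pow (tuples n X) \<subseteq> {Q. Q \<subseteq> tuples n (ultrafilters X) \<and> right_clopen n X Q}"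
    by (intro image_subsetI CollectI conjI tilde_rel_subset right_clopen_tilde_rel)
  moreover have "e_rel n X ` ultrafilters (Pow (tuples n X)) =
      tilde_rel n X ` limit_set (tuples n X) ` ultrafilters (Pow (tuples n X))"
    by (simp add: image_image e_rel_eq)
  ultimately show ?thesis
    unfolding limit_set_image by (simp only: subset_antisym)
qed

section \<open>Regular closed relations\<close>

lemma tuple1_in_tuples: "tuple1 y \<in> tuples 1 Y \<longleftrightarrow> y \<in> Y"
  by (auto simp: tuple1_def PiE_iff)

lemma image_tuple1_subset: "tuple1 ` Q \<subseteq> tuples 1 Y \<longleftrightarrow> Q \<subseteq> Y"
  unfolding image_subset_iff tuple1_in_tuples by blast

lemma tuple1_0: "tuple1 y 0 = y"
  by (simp add: tuple1_def)

lemma inj_tuple1: "inj tuple1"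
  by (rule inj_on_inverseI[where g = "\<lambda>t. t 0"]) (rule tuple1_0)

text \<open>The limit set commutes with the renaming \<open>tuple1\<close>, and for arity 1 the
  iterated quantifier is a single membership test in \<open>q\<close>.\<close>

lemma e_unary_eq:
  assumes r: "r \<in> ultrafilters (Pow Y)"
  shows "e_unary Y r = ufs_containing Y (limit_set Y r)"
proof -
  define r' where "r' = uf_map (Pow Y) (Pow (tuples 1 Y)) (\<lambda>Q. tuple1 ` Q) r"
  have "(\<lambda>Q. tuple1 ` Q) \<in> Pow Y \<rightarrow> Pow (tuples 1 Y)"
    by (rule Pi_I) (simp only: Pow_iff image_tuple1_subset)
  then have "r' \<in> ultrafilters (Pow (tuples 1 Y))"
    unfolding r'_def by (rule uf_map_ultrafilter[OF r])
  then have e: "e_rel 1 Y r' = tilde_rel 1 Y (limit_set (tuples 1 Y) r')"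
    by (rule e_rel_eq)
  define L where "L = limit_set (tuples 1 Y) r'"
  have lim: "tuple1 y \<in> L \<longleftrightarrow> y \<in> limit_set Y r" for y
  proof (cases "y \<in> Y")
    case True
    let ?B = "{R. R \<subseteq> tuples 1 Y \<and> tuple1 y \<in> R}"
    have "{Q \<in> Pow Y. tuple1 ` Q \<in> ?B} = {Q. Q \<subseteq> Y \<and> y \<in> Q}"
      by (simp only: mem_Collect_eq image_tuple1_subset inj_image_mem_iff[OF inj_tuple1] Pow_iff) blast
    moreover have "?B \<in> r' \<longleftrightarrow> ?B \<subseteq> Pow (tuples 1 Y) \<and> {Q \<in> Pow Y. tuple1 ` Q \<in> ?B} \<in> r"
      unfolding r'_def by (rule uf_map_iff)
    moreover have "?B \<subseteq> Pow (tuples 1 Y)"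
      by blast
    ultimately have "?B \<in> r' \<longleftrightarrow> {Q. Q \<subseteq> Y \<and> y \<in> Q} \<in> r"
      by (simp only: simp_thms)
    then show ?thesis
      using True tuple1_in_tuples[of y Y] by (simp add: L_def limit_set_def)
  next
    case False
    then show ?thesis
      using tuple1_in_tuples[of y Y] by (simp add: L_def limit_set_def)
  qed
  \<comment> \<open>The base clause of \<open>uf_all\<close> starts from the constantly
    \<open>undefined\<close> tuple; updating it at 0 gives the extensional 1-tuple.\<close>
  have upd: "(\<lambda>_. undefined)(0 := y) = tuple1 y" for y :: 'a
    by (auto simp: tuple1_def)
  have "tuple1 q \<in> e_rel 1 Y r' \<longleftrightarrow> limit_set Y r \<in> q" if q: "q \<in> ultrafilters Y" for q
  proof -
    have "tuple1 q 0 = q"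
      by (rule tuple1_0)
    moreover have "{y \<in> Y. tuple1 y \<in> L} = limit_set Y r"
      using limit_set_subset[of Y r] by (auto simp: lim)
    ultimately have "uf_all Y (tuple1 q) 1 (\<lambda>x. x \<in> L) \<longleftrightarrow> limit_set Y r \<in> q"
      by (simp add: upd)
    then show ?thesis
      unfolding e L_def[symmetric] tilde_rel_def using tuple1_in_tuples[of q "ultrafilters Y"] q by blast
  qed
  then show ?thesis
    unfolding e_unary_def r'_def[symmetric] ufs_containing_def by blast
qed

text \<open>The closure formula for coordinate images, with \<open>I = {..<n}\<close> and the limit
  set as \<open>P\<close>.\<close>

lemma E_rel_eq:
  assumes "r \<in> ultrafilters (Pow (tuples n X))"
  shows "E_rel n X r = product_topology (\<lambda>_. beta_top X) {..<n} closure_of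
    (principal_tuple n X ` limit_set (tuples n X) r)"
proof -
  have "E_rel n X r = uf_coords {..<n} X ` ufs_containing (tuples n X) (limit_set (tuples n X) r)"
    unfolding E_rel_def e_unary_eq[OF assms] by (intro image_cong) (simp_all add: uf_coords_def)
  then show ?thesis
    unfolding projections_image_eq_closure[OF limit_set_subset] principal_tuple_def .
qed

text \<open>Principal ultrafilters are isolated points of \<beta>X, and a tuple of finitely many
  isolated points is isolated in the product.\<close>

lemma openin_principal_tuples:
  assumes "P \<subseteq> tuples n X"
  shows "openin (product_topology (\<lambda>_. beta_top X) {..<n}) (principal_tuple n X ` P)"
proof -
  have "openin (product_topology (\<lambda>_. beta_top X) {..<n}) {principal_tuple n X x}" if "x \<in> P" for x
  proof -
    have "(\<Pi>\<^sub>E i\<in>{..<n}. {principal_tuple n X x i}) = {principal_tuple n X x}"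
      unfolding principal_tuple_def by (rule PiE_singleton[OF restrict_extensional])
    moreover have "openin (beta_top X) {principal_tuple n X x i}" if "i < n" for i
    proof -
      have "x i \<in> X"
        using assms \<open>x \<in> P\<close> that by blast
      then show ?thesis
        using openin_principal_uf that by (simp add: principal_tuple_def)
    qed
    then have "openin (product_topology (\<lambda>_. beta_top X) {..<n})
        (\<Pi>\<^sub>E i\<in>{..<n}. {principal_tuple n X x i})"
      unfolding openin_PiE_gen by simp
    ultimately show ?thesis
      by simp
  qed
  then have "openin (product_topology (\<lambda>_. beta_top X) {..<n}) (\<Union>x\<in>P. {principal_tuple n X x})"
    by blast
  then show ?thesis
    by (simp add: UNION_singleton_eq_range)
qed

text \<open>An open \<open>U\<close> has the same closure as its trace on the dense set X^n;
  conversely, every subset of X^n is open in the product.\<close>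

lemma regular_closed_iff:
  "regular_closed (product_topology (\<lambda>_. beta_top X) {..<n}) S \<longleftrightarrow>
    (\<exists>P\<subseteq>tuples n X. S = product_topology (\<lambda>_. beta_top X) {..<n} closure_of (principal_tuple n X ` P))"
    (is "regular_closed ?T S \<longleftrightarrow> ?rhs")
proof
  assume "regular_closed ?T S"
  then obtain U where U: "openin ?T U" "S = ?T closure_of U"
    by (auto simp: regular_closed_def)
  define P where "P = {x \<in> tuples n X. principal_tuple n X x \<in> U}"
  have "?T closure_of (principal_tuple n X ` tuples n X) = topspace ?T"
    using principal_tuples_dense[of X "{..<n}"] by (simp add: principal_tuple_def)
  then have "U \<inter> ?T closure_of (principal_tuple n X ` tuples n X) = U"
    using openin_subset[OF U(1)] by blast
  then have "S = ?T closure_of (U \<inter> principal_tuple n X ` tuples n X)"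
    using closure_of_openin_Int_closure_of[OF U(1)] U(2) by metis
  also have "U \<inter> principal_tuple n X ` tuples n X = principal_tuple n X ` P"
    unfolding P_def by blast
  finally have "S = ?T closure_of (principal_tuple n X ` P)" .
  moreover have "P \<subseteq> tuples n X"
    unfolding P_def by blast
  ultimately show ?rhs
    by (intro exI[of _ P] conjI)
next
  assume ?rhs
  then obtain P where P: "P \<subseteq> tuples n X" "S = ?T closure_of (principal_tuple n X ` P)"
    by (elim exE conjE)
  then show "regular_closed ?T S"
    unfolding regular_closed_def
    by (intro exI[of _ "principal_tuple n X ` P"] conjI openin_principal_tuples)
qed

text \<open>Every subset of X^n is the limit set of some ultrafilter, so all closures of such
  subsets occur.\<close>

lemma E_rel_image:
  "E_rel n X ` ultrafilters (Pow (tuples n X)) =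
    {Q. regular_closed (product_topology (\<lambda>_. beta_top X) {..<n}) Q}"
proof -
  have "E_rel n X ` ultrafilters (Pow (tuples n X)) =
      (\<lambda>P. product_topology (\<lambda>_. beta_top X) {..<n} closure_of (principal_tuple n X ` P)) `
        limit_set (tuples n X) ` ultrafilters (Pow (tuples n X))"
    by (simp add: image_image E_rel_eq)
  then show ?thesis
    unfolding limit_set_image regular_closed_iff
    unfolding image_def[where A = "Pow (tuples n X)"] Bex_def Pow_iff .
qed

section \<open>Models\<close>

text \<open>Reduces the existence of an interpretation to a condition on each symbol: preimages are
  selected by choice, and extensionality settles the equation off \<open>S\<close>.\<close>

lemma extensional_factor_iff:
  assumes "a \<in> extensional S"
  shows "(\<exists>g \<in> Pi\<^sub>E S U. a = (\<lambda>s\<in>S. e s (g s))) \<longleftrightarrow> (\<forall>s\<in>S. a s \<in> e s ` U s)"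
proof
  assume a: "\<forall>s\<in>S. a s \<in> e s ` U s"
  define g where "g = (\<lambda>s\<in>S. SOME y. y \<in> U s \<and> a s = e s y)"
  have g: "g s \<in> U s \<and> a s = e s (g s)" if "s \<in> S" for s
  proof -
    have "\<exists>y. y \<in> U s \<and> a s = e s y"
      using bspec[OF a that] by blast
    then show ?thesis
      unfolding g_def restrict_apply'[OF that] by (rule someI_ex)
  qed
  have "g \<in> Pi\<^sub>E S U"
    using g by (simp add: PiE_iff g_def)
  moreover have "a = (\<lambda>s\<in>S. e s (g s))"
    by (rule extensionalityI[OF assms restrict_extensional]) (simp add: g)
  ultimately show "\<exists>g \<in> Pi\<^sub>E S U. a = (\<lambda>s\<in>S. e s (g s))"
    by blast
next
  assume "\<exists>g \<in> Pi\<^sub>E S U. a = (\<lambda>s\<in>S. e s (g s))"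
  then obtain g where g: "g \<in> Pi\<^sub>E S U" "a = (\<lambda>s\<in>S. e s (g s))"
    by (elim bexE)
  show "\<forall>s\<in>S. a s \<in> e s ` U s"
    using PiE_mem[OF g(1)] by (simp add: g(2))
qed

text \<open>A generalized model is a pair of independent interpretations, so its existence splits
  into one statement for functional and one for predicate symbols.\<close>

lemma e_model_iff:
  "(\<exists>B. narrow_gmodel \<sigma> X B \<and> A = e_model \<sigma> X B) \<longleftrightarrow>
    universe A = ultrafilters X \<and>
    (\<exists>g \<in> \<Pi>\<^sub>E F\<in>fun_syms \<sigma>. ultrafilters (tuples (fun_arity \<sigma> F) X \<rightarrow>\<^sub>E X).
       fun_int A = (\<lambda>F\<in>fun_syms \<sigma>. e_fun (fun_arity \<sigma> F) X (g F))) \<and>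
    (\<exists>r \<in> \<Pi>\<^sub>E R\<in>rel_syms \<sigma>. ultrafilters (Pow (tuples (rel_arity \<sigma> R) X)).
       rel_int A = (\<lambda>R\<in>rel_syms \<sigma>. e_rel (rel_arity \<sigma> R) X (r R)))"
  (is "?lhs \<longleftrightarrow> ?rhs")
proof
  assume ?rhs
  then obtain g r where
    "narrow_gmodel \<sigma> X \<lparr>gfun_int = g, grel_int = r\<rparr>"
    "A = e_model \<sigma> X \<lparr>gfun_int = g, grel_int = r\<rparr>"
    unfolding narrow_gmodel_def e_model_def by (cases A) auto
  then show ?lhs by blast
qed (auto simp: narrow_gmodel_def e_model_def)

lemma E_model_iff:
  "(\<exists>B. narrow_gmodel \<sigma> X B \<and> A = E_model \<sigma> X B) \<longleftrightarrow>
    universe A = ultrafilters X \<and>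
    (\<exists>g \<in> \<Pi>\<^sub>E F\<in>fun_syms \<sigma>. ultrafilters (tuples (fun_arity \<sigma> F) X \<rightarrow>\<^sub>E X).
       fun_int A = (\<lambda>F\<in>fun_syms \<sigma>. e_fun (fun_arity \<sigma> F) X (g F))) \<and>
    (\<exists>r \<in> \<Pi>\<^sub>E R\<in>rel_syms \<sigma>. ultrafilters (Pow (tuples (rel_arity \<sigma> R) X)).
       rel_int A = (\<lambda>R\<in>rel_syms \<sigma>. E_rel (rel_arity \<sigma> R) X (r R)))"
  (is "?lhs \<longleftrightarrow> ?rhs")
proof
  assume ?rhs
  then obtain g r where
    "narrow_gmodel \<sigma> X \<lparr>gfun_int = g, grel_int = r\<rparr>"
    "A = E_model \<sigma> X \<lparr>gfun_int = g, grel_int = r\<rparr>"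
    unfolding narrow_gmodel_def E_model_def by (cases A) auto
  then show ?lhs by blast
qed (auto simp: narrow_gmodel_def E_model_def)

theorem theorem29:
  fixes \<sigma> :: "('f, 'r) signature"
    and X :: "'a set"
    and A :: "('f, 'r, 'a set set) model"
  assumes "ordinary_model \<sigma> A"
    and "universe A = ultrafilters X"
  shows "((\<exists>B. narrow_gmodel \<sigma> X B \<and> A = e_model \<sigma> X B) \<longleftrightarrow>
            (\<forall>F\<in>fun_syms \<sigma>. right_continuous (fun_arity \<sigma> F) X (beta_top X) (fun_int A F)) \<and>
            (\<forall>R\<in>rel_syms \<sigma>. right_clopen (rel_arity \<sigma> R) X (rel_int A R)))
       \<and> ((\<exists>B. narrow_gmodel \<sigma> X B \<and> A = E_model \<sigma> X B) \<longleftrightarrow>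
            (\<forall>F\<in>fun_syms \<sigma>. right_continuous (fun_arity \<sigma> F) X (beta_top X) (fun_int A F)) \<and>
            (\<forall>R\<in>rel_syms \<sigma>. regular_closed
               (product_topology (\<lambda>_. beta_top X) {..<rel_arity \<sigma> R}) (rel_int A R)))"
proof -
  have fun_A: "fun_int A \<in> (\<Pi>\<^sub>E F\<in>fun_syms \<sigma>. tuples (fun_arity \<sigma> F) (ultrafilters X) \<rightarrow>\<^sub>E ultrafilters X)"
    and rel_A: "rel_int A \<in> (\<Pi>\<^sub>E R\<in>rel_syms \<sigma>. Pow (tuples (rel_arity \<sigma> R) (ultrafilters X)))"
    using assms by (simp_all add: ordinary_model_def)
  then have ext: "fun_int A \<in> extensional (fun_syms \<sigma>)" "rel_int A \<in> extensional (rel_syms \<sigma>)"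
    by (simp_all add: PiE_iff)
  have funs: "fun_int A F \<in> rc_ops (fun_arity \<sigma> F) X (beta_top X) \<longleftrightarrow>
      right_continuous (fun_arity \<sigma> F) X (beta_top X) (fun_int A F)" if "F \<in> fun_syms \<sigma>" for F
    using PiE_mem[OF fun_A that] by (simp add: rc_ops_def)
  have rels: "rel_int A R \<subseteq> tuples (rel_arity \<sigma> R) (ultrafilters X)" if "R \<in> rel_syms \<sigma>" for R
    using PiE_mem[OF rel_A that] by simp
  \<comment> \<open>Symbol by symbol, the three image lemmas list the values that occur;
    \<open>funs\<close> and \<open>rels\<close> supply the typing conditions contained in the first
    two.\<close>
  show ?thesis
    unfolding e_model_iff E_model_iff
      extensional_factor_iff[OF ext(1), where e = "\<lambda>F. e_fun (fun_arity \<sigma> F) X"]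
      extensional_factor_iff[OF ext(2), where e = "\<lambda>R. e_rel (rel_arity \<sigma> R) X"]
      extensional_factor_iff[OF ext(2), where e = "\<lambda>R. E_rel (rel_arity \<sigma> R) X"]
      e_fun_image e_rel_image E_rel_image
    using assms(2) funs rels by simp
qed

end
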